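(* Let $n\ge 3$ and let $(M,g)$ be an $n$-dimensional compact Riemannian manifold (without boundary) which is a Yamabe gradient soliton, i.e. there exist a smooth function $f:M\to\mathbb{R}$ and a constant $\rho\in\mathbb{R}$ such that $$(R-\rho)\,g_{ij}=\nabla_i\nabla_j f\qquad\text{on } M,$$ where $R$ is the scalar curvature of $g$. Then $(M,g)$ has constant scalar curvature, i.e. $R$ is constant on $M$.
   Context: Here $(M,g)$ is a smooth Riemannian manifold, $\nabla$ is the Levi-Civita connection of $g$, $\nabla_i\nabla_j f$ denotes the components of the Hessian of $f$ with respect to $g$, and $R$ denotes the scalar curvature function of $g$. *)

theory Defs
  imports "HOL-Analysis.Analysis"
begin

section \<open>Smooth maps on open subsets of Euclidean space\<close>

definition pd :: "'n::finite \<Rightarrow> (real ^ 'n \<Rightarrow> 'b::real_normed_vector) \<Rightarrow> real ^ 'n \<Rightarrow> 'b"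
  where "pd i f x = frechet_derivative f (at x) (axis i 1)"

primrec Ck_on ::
  "nat \<Rightarrow> (real ^ 'n::finite) set \<Rightarrow> (real ^ 'n \<Rightarrow> 'b::real_normed_vector) \<Rightarrow> bool"
  where
    "Ck_on 0 S f \<longleftrightarrow> continuous_on S f"
  | "Ck_on (Suc k) S f \<longleftrightarrow> (\<forall>x\<in>S. f differentiable at x) \<and> (\<forall>i. Ck_on k S (pd i f))"

text \<open>Meant for open \<open>S\<close>; then only the values of \<open>f\<close> on \<open>S\<close> matter.\<close>

definition smooth_on ::
  "(real ^ 'n::finite) set \<Rightarrow> (real ^ 'n \<Rightarrow> 'b::real_normed_vector) \<Rightarrow> bool"
  where "smooth_on S f \<longleftrightarrow> (\<forall>k. Ck_on k S f)"


section \<open>Smooth manifolds\<close>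

text \<open>A chart is a domain together with its coordinate map; the values of the coordinate map
  outside the domain are irrelevant. The dimension of the manifold is \<open>CARD('n)\<close>.\<close>

type_synonym ('a, 'n) chart = "'a set \<times> ('a \<Rightarrow> real ^ 'n)"

abbreviation chart_dom :: "('a, 'n::finite) chart \<Rightarrow> 'a set"
  where "chart_dom c \<equiv> fst c"

abbreviation chart_img :: "('a, 'n::finite) chart \<Rightarrow> (real ^ 'n) set"
  where "chart_img c \<equiv> snd c ` fst c"

definition param :: "('a, 'n::finite) chart \<Rightarrow> real ^ 'n \<Rightarrow> 'a"
  where "param c = inv_into (fst c) (snd c)"

definition is_chart :: "'a topology \<Rightarrow> ('a, 'n::finite) chart \<Rightarrow> bool"
  where "is_chart M c \<longleftrightarrow> openin M (chart_dom c) \<and> open (chart_img c) \<and>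
    homeomorphic_map (subtopology M (chart_dom c)) (top_of_set (chart_img c)) (snd c)"

text \<open>The smooth structure is the one determined by the atlas, which need not be maximal.\<close>

definition smooth_manifold :: "'a topology \<Rightarrow> ('a, 'n::finite) chart set \<Rightarrow> bool"
  where "smooth_manifold M A \<longleftrightarrow>
    Hausdorff_space M \<and> second_countable M \<and>
    (\<forall>c\<in>A. is_chart M c) \<and> (\<Union>c\<in>A. chart_dom c) = topspace M \<and>
    (\<forall>c\<in>A. \<forall>d\<in>A. smooth_on (snd c ` (chart_dom c \<inter> chart_dom d)) (snd d \<circ> param c))"

definition smooth_fun :: "('a, 'n::finite) chart set \<Rightarrow> ('a \<Rightarrow> real) \<Rightarrow> bool"
  where "smooth_fun A f \<longleftrightarrow> (\<forall>c\<in>A. smooth_on (chart_img c) (f \<circ> param c))"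

text \<open>Smoothness on some neighbourhood of \<open>p\<close>.\<close>

definition smooth_near :: "('a, 'n::finite) chart set \<Rightarrow> 'a \<Rightarrow> ('a \<Rightarrow> real) \<Rightarrow> bool"
  where "smooth_near A p h \<longleftrightarrow> (\<forall>c\<in>A. p \<in> chart_dom c \<longrightarrow>
    (\<exists>W. open W \<and> snd c p \<in> W \<and> W \<subseteq> chart_img c \<and> smooth_on W (h \<circ> param c)))"

text \<open>Tangent vectors at \<open>p\<close> are the derivations at \<open>p\<close> of the functions that are smooth near
  \<open>p\<close>. The Leibniz rule, applied to a factor that is locally constant at \<open>p\<close>, makes them depend
  only on germs. The last clause normalises the irrelevant values.\<close>

definition tangent_space :: "('a, 'n::finite) chart set \<Rightarrow> 'a \<Rightarrow> (('a \<Rightarrow> real) \<Rightarrow> real) set"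
  where "tangent_space A p = {X.
    (\<forall>h k a b. smooth_near A p h \<longrightarrow> smooth_near A p k \<longrightarrow>
      X (\<lambda>q. a * h q + b * k q) = a * X h + b * X k) \<and>
    (\<forall>h k. smooth_near A p h \<longrightarrow> smooth_near A p k \<longrightarrow>
      X (\<lambda>q. h q * k q) = h p * X k + k p * X h) \<and>
    (\<forall>h. \<not> smooth_near A p h \<longrightarrow> X h = 0)}"

text \<open>The coordinate vector $\partial_i$ at \<open>p\<close>.\<close>

definition coord_vec ::
  "('a, 'n::finite) chart set \<Rightarrow> ('a, 'n) chart \<Rightarrow> 'n \<Rightarrow> 'a \<Rightarrow> ('a \<Rightarrow> real) \<Rightarrow> real"
  where "coord_vec A c i p h =
    (if smooth_near A p h then pd i (h \<circ> param c) (snd c p) else 0)"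


section \<open>Riemannian metrics\<close>

text \<open>Components $g_{ij}$ in a chart, as functions of the coordinates.\<close>

definition metric_comp ::
  "('a, 'n::finite) chart set \<Rightarrow>
   ('a \<Rightarrow> (('a \<Rightarrow> real) \<Rightarrow> real) \<Rightarrow> (('a \<Rightarrow> real) \<Rightarrow> real) \<Rightarrow> real) \<Rightarrow>
   ('a, 'n) chart \<Rightarrow> real ^ 'n \<Rightarrow> real ^ 'n ^ 'n"
  where "metric_comp A g c x =
    (\<chi> i j. g (param c x) (coord_vec A c i (param c x)) (coord_vec A c j (param c x)))"

definition riemannian_metric ::
  "('a, 'n::finite) chart set \<Rightarrow>
   ('a \<Rightarrow> (('a \<Rightarrow> real) \<Rightarrow> real) \<Rightarrow> (('a \<Rightarrow> real) \<Rightarrow> real) \<Rightarrow> real) \<Rightarrow> bool"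
  where "riemannian_metric A g \<longleftrightarrow>
    (\<forall>p \<in> (\<Union>c\<in>A. chart_dom c).
      (\<forall>X\<in>tangent_space A p. \<forall>Y\<in>tangent_space A p. g p X Y = g p Y X) \<and>
      (\<forall>X\<in>tangent_space A p. \<forall>Y\<in>tangent_space A p. \<forall>Z\<in>tangent_space A p. \<forall>a b.
        g p (\<lambda>h. a * X h + b * Y h) Z = a * g p X Z + b * g p Y Z) \<and>
      (\<forall>X\<in>tangent_space A p. X \<noteq> (\<lambda>h. 0) \<longrightarrow> g p X X > 0)) \<and>
    (\<forall>c\<in>A. \<forall>i j. smooth_on (chart_img c) (\<lambda>x. metric_comp A g c x $ i $ j))"


section \<open>Levi-Civita connection and curvature in local coordinates\<close>

text \<open>Here \<open>G\<close> is the matrix of components of a metric on an open subset of coordinate space;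
  \<open>christoffel G k i j\<close> is the coefficient $\Gamma^k_{ij}$ of the Levi-Civita connection.\<close>

definition christoffel ::
  "(real ^ 'n \<Rightarrow> real ^ 'n ^ 'n) \<Rightarrow> 'n::finite \<Rightarrow> 'n \<Rightarrow> 'n \<Rightarrow> real ^ 'n \<Rightarrow> real"
  where "christoffel G k i j x = (\<Sum>l\<in>UNIV. matrix_inv (G x) $ k $ l *
    (pd i (\<lambda>y. G y $ j $ l) x + pd j (\<lambda>y. G y $ i $ l) x - pd l (\<lambda>y. G y $ i $ j) x)) / 2"

text \<open>$\nabla_i \omega_j$ for a covector field $\omega$.\<close>

definition cov_deriv ::
  "(real ^ 'n \<Rightarrow> real ^ 'n ^ 'n) \<Rightarrow> 'n::finite \<Rightarrow> ('n \<Rightarrow> real ^ 'n \<Rightarrow> real) \<Rightarrow> 'n \<Rightarrow> real ^ 'n \<Rightarrow> real"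
  where "cov_deriv G i \<omega> j x =
    pd i (\<omega> j) x - (\<Sum>k\<in>UNIV. christoffel G k i j x * \<omega> k x)"

text \<open>$\nabla_i \nabla_j u$, the covariant derivative of $du$.\<close>

definition hessian_coord ::
  "(real ^ 'n \<Rightarrow> real ^ 'n ^ 'n) \<Rightarrow> (real ^ 'n \<Rightarrow> real) \<Rightarrow> 'n::finite \<Rightarrow> 'n \<Rightarrow> real ^ 'n \<Rightarrow> real"
  where "hessian_coord G u i j x = cov_deriv G i (\<lambda>k. pd k u) j x"

text \<open>\<open>riemann G l k i j\<close> is $R^l{}_{kij}$, where
  $(\nabla_i \nabla_j - \nabla_j \nabla_i) \partial_k = R^l{}_{kij} \partial_l$, and
  $R_{kj} = R^i{}_{kij}$. With this convention round spheres have positive scalar curvature.\<close>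

definition riemann ::
  "(real ^ 'n \<Rightarrow> real ^ 'n ^ 'n) \<Rightarrow> 'n::finite \<Rightarrow> 'n \<Rightarrow> 'n \<Rightarrow> 'n \<Rightarrow> real ^ 'n \<Rightarrow> real"
  where "riemann G l k i j x =
    pd i (christoffel G l j k) x - pd j (christoffel G l i k) x +
    (\<Sum>m\<in>UNIV. christoffel G l i m x * christoffel G m j k x -
               christoffel G l j m x * christoffel G m i k x)"

definition ricci ::
  "(real ^ 'n \<Rightarrow> real ^ 'n ^ 'n) \<Rightarrow> 'n::finite \<Rightarrow> 'n \<Rightarrow> real ^ 'n \<Rightarrow> real"
  where "ricci G k j x = (\<Sum>i\<in>UNIV. riemann G i k i j x)"

definition scalar_coord :: "(real ^ 'n::finite \<Rightarrow> real ^ 'n ^ 'n) \<Rightarrow> real ^ 'n \<Rightarrow> real"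
  where "scalar_coord G x = (\<Sum>k\<in>UNIV. \<Sum>j\<in>UNIV. matrix_inv (G x) $ k $ j * ricci G k j x)"


section \<open>Yamabe gradient solitons\<close>

definition hessian ::
  "('a, 'n::finite) chart set \<Rightarrow>
   ('a \<Rightarrow> (('a \<Rightarrow> real) \<Rightarrow> real) \<Rightarrow> (('a \<Rightarrow> real) \<Rightarrow> real) \<Rightarrow> real) \<Rightarrow>
   ('a, 'n) chart \<Rightarrow> ('a \<Rightarrow> real) \<Rightarrow> 'n \<Rightarrow> 'n \<Rightarrow> 'a \<Rightarrow> real"
  where "hessian A g c f i j p =
    hessian_coord (metric_comp A g c) (f \<circ> param c) i j (snd c p)"

text \<open>The scalar curvature at \<open>p\<close>, computed in the chart \<open>c\<close> around \<open>p\<close>. Its value does not depend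
  on the chart; rather than selecting one, the notions below speak about every chart.\<close>

definition scalar_curvature ::
  "('a, 'n::finite) chart set \<Rightarrow>
   ('a \<Rightarrow> (('a \<Rightarrow> real) \<Rightarrow> real) \<Rightarrow> (('a \<Rightarrow> real) \<Rightarrow> real) \<Rightarrow> real) \<Rightarrow>
   ('a, 'n) chart \<Rightarrow> 'a \<Rightarrow> real"
  where "scalar_curvature A g c p = scalar_coord (metric_comp A g c) (snd c p)"

definition yamabe_gradient_soliton ::
  "('a, 'n::finite) chart set \<Rightarrow>
   ('a \<Rightarrow> (('a \<Rightarrow> real) \<Rightarrow> real) \<Rightarrow> (('a \<Rightarrow> real) \<Rightarrow> real) \<Rightarrow> real) \<Rightarrow> bool"
  where "yamabe_gradient_soliton A g \<longleftrightarrow> (\<exists>f \<rho>. smooth_fun A f \<and>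
    (\<forall>c\<in>A. \<forall>p\<in>chart_dom c. \<forall>i j.
      (scalar_curvature A g c p - \<rho>) * metric_comp A g c (snd c p) $ i $ j =
      hessian A g c f i j p))"

definition constant_scalar_curvature ::
  "('a, 'n::finite) chart set \<Rightarrow>
   ('a \<Rightarrow> (('a \<Rightarrow> real) \<Rightarrow> real) \<Rightarrow> (('a \<Rightarrow> real) \<Rightarrow> real) \<Rightarrow> real) \<Rightarrow> bool"
  where "constant_scalar_curvature A g \<longleftrightarrow>
    (\<exists>\<kappa>. \<forall>c\<in>A. \<forall>p\<in>chart_dom c. scalar_curvature A g c p = \<kappa>)"

end

(*
  Let phi = R - rho, so that Hess f = phi g. Commuting derivatives gives Ric(grad f) = -(n-1) d phi
  and d phi parallel to df; together with the contracted second Bianchi identity this yields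
  (n-1) Lap phi + <d phi, df>/2 + phi (phi + rho) = 0. Where df does not vanish the metric is a
  warped product over the level sets of f, and these relations combine into a monotonicity formula:
  the function

    Q = |df|^(n-2) ( |df|^2 (rho/n - (phi+rho)/(n-2)) - 2(n-1)/(n-2) <d phi, df> )

  satisfies <dQ, df> = - |df|^n phi^2, and it vanishes at the critical points of f because n > 2.
  Hence for eps > 0 the function Q - eps f has no regular point of f as an extremum, so its maximum
  and minimum over the compact manifold are attained where Q = 0. Letting eps tend to 0 gives Q = 0
  everywhere, so phi = 0 at the regular points of f. On open sets of critical points phi = 0
  because Hess f = 0 there, and R = rho follows by continuity.
*)
theory Submission
  imports Defs
begin

subsection \<open>Partial derivatives and smooth functions\<close>

text \<open>Integrated over M, the equation for Lap phi would finish at once: Lap phi and phi have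
  mean zero, and <d phi, df> integrates to -n times the integral of phi^2, so (n/2 - 1) times that
  integral is zero. Q performs this integration along gradient lines. With h = |df|, the warped
  product has volume density h^(n-1), and phi = h'. Multiplying the equation by h^(n-1) and
  collecting exact derivatives leaves only (1 - n/2) h^(n-1) phi^2, and -2/(n-2) times the
  antiderivative of the exact part is Q. This is the origin of its coefficients; neither integrals
  over M nor warped coordinates occur in the proof. The other obstacle is that curvature is given
  chart by chart. Its transformation law is never derived: only <du, dv> is shown to be independent
  of the chart, through the metric on tangent vectors. At regular points phi is recovered from
  <d|df|^2, df> = 2 phi |df|^2; at critical points the factor |df|^(n-2) makes Q zero in every
  chart. So Q is well defined on M before R is known to be.\<close>

lemma pd_eqI:
  assumes "(f has_derivative D) (at x)"
  shows "pd i f x = D (axis i 1)"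
  using frechet_derivative_at[OF assms] by (simp add: pd_def)

lemma pd_cong_open:
  assumes "open S" "x \<in> S" "\<And>y. y \<in> S \<Longrightarrow> f y = g y"
  shows "pd i f x = pd i g x"
proof -
  have "(f has_derivative D) (at x) \<longleftrightarrow> (g has_derivative D) (at x)" for D
    using has_derivative_transform_within_open[of f D x UNIV S g]
      has_derivative_transform_within_open[of g D x UNIV S f] assms by auto
  then show ?thesis by (simp add: pd_def frechet_derivative_def)
qed

lemma differentiable_cong_open:
  assumes "open S" "x \<in> S" "\<And>y. y \<in> S \<Longrightarrow> f y = g y" "f differentiable at x"
  shows "g differentiable at x"
  using has_derivative_transform_within_open[of f _ x UNIV S g] assms
  unfolding differentiable_def by blast

lemma Ck_on_cong:
  assumes "open S" "\<And>x. x \<in> S \<Longrightarrow> f x = g x" "Ck_on k S f"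
  shows "Ck_on k S g"
  using assms(2,3)
proof (induction k arbitrary: f g)
  case 0
  then show ?case using continuous_on_cong by force
next
  case (Suc k)
  have "\<forall>x\<in>S. g differentiable at x"
    using Suc.prems differentiable_cong_open[OF \<open>open S\<close>, of _ f g] by simp
  moreover have "Ck_on k S (pd i g)" for i
    using Suc.prems by (intro Suc.IH[of "pd i f" "pd i g"] pd_cong_open[OF \<open>open S\<close>]) auto
  ultimately show ?case by simp
qed

lemma Ck_on_mono: "Ck_on k S f \<Longrightarrow> T \<subseteq> S \<Longrightarrow> Ck_on k T f"
  by (induction k arbitrary: f) (auto intro: continuous_on_subset)

text \<open>\<open>Ck_on (Suc k)\<close> mentions no lower order explicitly; at the bottom of the
  recursion, differentiability supplies the continuity.\<close>

lemma Ck_on_Suc_imp: "Ck_on (Suc k) S f \<Longrightarrow> Ck_on k S f"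
proof (induction k arbitrary: f)
  case 0
  then show ?case
    by (auto intro!: continuous_at_imp_continuous_on differentiable_imp_continuous_within)
next
  case (Suc k)
  then show ?case by (metis Ck_on.simps(2))
qed

lemma pd_const [simp]: "pd i (\<lambda>x. c) x = 0"
  by (rule pd_eqI[where D = "\<lambda>_. 0"]) simp

lemma pd_add:
  assumes "f differentiable at x" "g differentiable at x"
  shows "pd i (\<lambda>y. f y + g y) x = pd i f x + pd i g x"
  using pd_eqI[OF has_derivative_add[OF assms[unfolded frechet_derivative_works]]]
  by (simp add: pd_def)

lemma pd_mult:
  fixes f g :: "real ^ 'n::finite \<Rightarrow> real"
  assumes "f differentiable at x" "g differentiable at x"
  shows "pd i (\<lambda>y. f y * g y) x = pd i f x * g x + f x * pd i g x"
proof -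
  have "((\<lambda>y. f y * g y) has_derivative
      (\<lambda>h. f x * frechet_derivative g (at x) h + frechet_derivative f (at x) h * g x)) (at x)"
    using assms by (intro has_derivative_mult) (simp_all add: frechet_derivative_works)
  from pd_eqI[OF this] show ?thesis by (simp add: pd_def)
qed

lemma pd_cmult:
  fixes f :: "real ^ 'n::finite \<Rightarrow> real"
  assumes "f differentiable at x"
  shows "pd i (\<lambda>y. c * f y) x = c * pd i f x"
  using pd_mult[of "\<lambda>_. c" x f i] assms by simp

lemma pd_minus:
  fixes f :: "real ^ 'n::finite \<Rightarrow> real"
  assumes "f differentiable at x"
  shows "pd i (\<lambda>y. - f y) x = - pd i f x"
  using pd_cmult[OF assms, of i "-1"] by simp

lemma pd_diff:
  fixes f :: "real ^ 'n::finite \<Rightarrow> real"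
  assumes "f differentiable at x" "g differentiable at x"
  shows "pd i (\<lambda>y. f y - g y) x = pd i f x - pd i g x"
  using pd_eqI[OF has_derivative_diff[OF assms[unfolded frechet_derivative_works]]]
  by (simp add: pd_def)

lemma pd_sum:
  assumes "finite I" "\<And>l. l \<in> I \<Longrightarrow> f l differentiable at x"
  shows "pd i (\<lambda>y. \<Sum>l\<in>I. f l y) x = (\<Sum>l\<in>I. pd i (f l) x)"
proof -
  have "((\<lambda>y. \<Sum>l\<in>I. f l y) has_derivative
      (\<lambda>h. \<Sum>l\<in>I. frechet_derivative (f l) (at x) h)) (at x)"
    using assms(2) by (intro has_derivative_sum) (simp add: frechet_derivative_works)
  from pd_eqI[OF this] show ?thesis by (simp add: pd_def)
qed

lemma pd_compose_real:
  fixes f :: "real ^ 'n::finite \<Rightarrow> real"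
  assumes "f differentiable at x" "(F has_real_derivative D) (at (f x))"
  shows "(\<lambda>y. F (f y)) differentiable at x" "pd i (\<lambda>y. F (f y)) x = D * pd i f x"
proof -
  have *: "((\<lambda>y. F (f y)) has_derivative (\<lambda>h. D * frechet_derivative f (at x) h)) (at x)"
    using assms has_derivative_compose[of f "frechet_derivative f (at x)" x UNIV F "(*) D"]
    by (simp add: frechet_derivative_works has_field_derivative_def)
  show "(\<lambda>y. F (f y)) differentiable at x"
    using * by (auto simp: differentiable_def)
  show "pd i (\<lambda>y. F (f y)) x = D * pd i f x"
    using pd_eqI[OF *] by (simp add: pd_def)
qed

lemma pd_inverse:
  fixes f :: "real ^ 'n::finite \<Rightarrow> real"
  assumes "f differentiable at x" "f x \<noteq> 0"
  shows "pd i (\<lambda>y. inverse (f y)) x = - (pd i f x * (inverse (f x) * inverse (f x)))"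
  using pd_compose_real(2)[OF assms(1) DERIV_inverse[OF assms(2)], of i]
  by (simp add: ac_simps)

lemma differentiable_nth:
  fixes f :: "real ^ 'n::finite \<Rightarrow> real ^ 'm::finite"
  assumes "f differentiable at x"
  shows "(\<lambda>y. f y $ k) differentiable at x"
  using assms bounded_linear.has_derivative[OF bounded_linear_vec_nth, of f _ "at x" k]
  unfolding differentiable_def by blast

lemma pd_nth:
  fixes f :: "real ^ 'n::finite \<Rightarrow> real ^ 'm::finite"
  assumes "f differentiable at x"
  shows "pd i (\<lambda>y. f y $ k) x = pd i f x $ k"
proof -
  have "((\<lambda>y. f y $ k) has_derivative (\<lambda>h. frechet_derivative f (at x) h $ k)) (at x)"
    using assms by (intro bounded_linear.has_derivative[OF bounded_linear_vec_nth])
      (simp add: frechet_derivative_works)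
  from pd_eqI[OF this] show ?thesis by (simp add: pd_def)
qed

lemma frechet_derivative_eq_sum_pd:
  fixes f :: "real ^ 'n::finite \<Rightarrow> 'b::real_normed_vector"
  assumes "f differentiable at x"
  shows "frechet_derivative f (at x) v = (\<Sum>k\<in>UNIV. v $ k *\<^sub>R pd k f x)"
proof -
  have "linear (frechet_derivative f (at x))"
    using assms linear_frechet_derivative by blast
  then have "frechet_derivative f (at x) (\<Sum>k\<in>UNIV. v $ k *\<^sub>R axis k 1)
      = (\<Sum>k\<in>UNIV. v $ k *\<^sub>R pd k f x)"
    by (simp add: linear_sum linear_scale pd_def)
  then show ?thesis
    using basis_expansion[of v] by (simp add: scalar_mult_eq_scaleR)
qed

lemma pd_chain:
  fixes f :: "real ^ 'm::finite \<Rightarrow> real" and t :: "real ^ 'n::finite \<Rightarrow> real ^ 'm"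
  assumes "t differentiable at x" "f differentiable at (t x)"
  shows "pd i (\<lambda>y. f (t y)) x = (\<Sum>k\<in>UNIV. pd i t x $ k * pd k f (t x))"
proof -
  note * = has_derivative_compose[OF assms(1)[unfolded frechet_derivative_works]
      assms(2)[unfolded frechet_derivative_works]]
  show ?thesis
    unfolding pd_eqI[OF *] frechet_derivative_eq_sum_pd[OF assms(2)]
    by (simp add: pd_def[of i t])
qed

section \<open>Closure properties of smooth functions\<close>

lemma Ck_on_const: "Ck_on k S (\<lambda>x::real ^ 'n::finite. c)"
proof (induction k arbitrary: c)
  case (Suc k)
  have "pd i (\<lambda>x::real^'n. c) = (\<lambda>x. 0)" for i by (rule ext) simp
  then show ?case using Suc by simp
qed simp

lemma Ck_on_add:
  assumes "open S" "Ck_on k S f" "Ck_on k S g"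
  shows "Ck_on k S (\<lambda>x. f x + g x)"
  using assms(2,3)
proof (induction k arbitrary: f g)
  case 0
  then show ?case by (simp add: continuous_on_add)
next
  case (Suc k)
  have "Ck_on k S (pd i (\<lambda>x. f x + g x))" for i
    by (rule Ck_on_cong[OF \<open>open S\<close> _ Suc.IH[of "pd i f" "pd i g"]])
      (use Suc.prems in \<open>auto simp: pd_add\<close>)
  then show ?case using Suc.prems by simp
qed

lemma Ck_on_mult:
  fixes f g :: "real ^ 'n::finite \<Rightarrow> real"
  assumes "open S" "Ck_on k S f" "Ck_on k S g"
  shows "Ck_on k S (\<lambda>x. f x * g x)"
  using assms(2,3)
proof (induction k arbitrary: f g)
  case 0
  then show ?case by (simp add: continuous_on_mult)
next
  case (Suc k)
  have fg: "Ck_on k S f" "Ck_on k S g"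
    using Suc.prems Ck_on_Suc_imp[of k S f] Ck_on_Suc_imp[of k S g] by simp_all
  have "Ck_on k S (pd i (\<lambda>x. f x * g x))" for i
  proof (rule Ck_on_cong[OF \<open>open S\<close>])
    show "Ck_on k S (\<lambda>x. pd i f x * g x + f x * pd i g x)"
      using Suc.prems fg by (intro Ck_on_add Suc.IH \<open>open S\<close>) simp_all
  qed (use Suc.prems in \<open>auto simp: pd_mult\<close>)
  then show ?case using Suc.prems by (simp add: differentiable_mult)
qed

text \<open>The derivative of 1/f is a product of a derivative of f with factors 1/f, so C^k for 1/f
  already gives C^(k+1).\<close>

lemma Ck_on_inverse:
  fixes f :: "real ^ 'n::finite \<Rightarrow> real"
  assumes "open S" "\<And>x. x \<in> S \<Longrightarrow> f x \<noteq> 0" "Ck_on k S f"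
  shows "Ck_on k S (\<lambda>x. inverse (f x))"
  using assms(3)
proof (induction k)
  case 0
  then show ?case using assms(2) by (auto intro!: continuous_on_inverse)
next
  case (Suc k)
  then have I: "Ck_on k S (\<lambda>x. inverse (f x))"
    using Ck_on_Suc_imp by blast
  have "Ck_on k S (pd i (\<lambda>x. inverse (f x)))" for i
  proof (rule Ck_on_cong[OF \<open>open S\<close>])
    show "Ck_on k S (\<lambda>x. (-1) * (pd i f x * (inverse (f x) * inverse (f x))))"
      using Suc.prems I by (intro Ck_on_mult Ck_on_const \<open>open S\<close>) simp_all
  qed (use Suc.prems assms(2) in \<open>auto simp: pd_inverse\<close>)
  then show ?case using Suc.prems assms(2) by (simp add: differentiable_inverse)
qed

lemma Ck_on_nth:
  fixes f :: "real ^ 'n::finite \<Rightarrow> real ^ 'm::finite"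
  assumes "open S" "Ck_on k S f"
  shows "Ck_on k S (\<lambda>x. f x $ j)"
  using assms(2)
proof (induction k arbitrary: f)
  case 0
  then show ?case by (simp add: continuous_on_component)
next
  case (Suc k)
  have "Ck_on k S (pd i (\<lambda>x. f x $ j))" for i
    by (rule Ck_on_cong[OF \<open>open S\<close> _ Suc.IH[of "pd i f"]])
      (use Suc.prems in \<open>auto simp: pd_nth\<close>)
  then show ?case using Suc.prems by (simp add: differentiable_nth)
qed

lemma smooth_on_cong:
  "open S \<Longrightarrow> (\<And>x. x \<in> S \<Longrightarrow> f x = g x) \<Longrightarrow> smooth_on S f \<Longrightarrow> smooth_on S g"
  unfolding smooth_on_def using Ck_on_cong by blast

lemma smooth_on_mono: "smooth_on S f \<Longrightarrow> T \<subseteq> S \<Longrightarrow> smooth_on T f"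
  unfolding smooth_on_def using Ck_on_mono by blast

lemma smooth_on_differentiable: "smooth_on S f \<Longrightarrow> x \<in> S \<Longrightarrow> f differentiable at x"
  unfolding smooth_on_def by (metis Ck_on.simps(2))

lemma smooth_on_continuous_on: "smooth_on S f \<Longrightarrow> continuous_on S f"
  unfolding smooth_on_def by (metis Ck_on.simps(1))

lemma smooth_on_pd: "smooth_on S f \<Longrightarrow> smooth_on S (pd i f)"
  unfolding smooth_on_def by (metis Ck_on.simps(2))

lemma smooth_on_const: "smooth_on S (\<lambda>x. c)"
  unfolding smooth_on_def by (simp add: Ck_on_const)

lemma smooth_on_add:
  "open S \<Longrightarrow> smooth_on S f \<Longrightarrow> smooth_on S g \<Longrightarrow> smooth_on S (\<lambda>x. f x + g x)"
  unfolding smooth_on_def by (simp add: Ck_on_add)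

lemma smooth_on_mult:
  fixes f g :: "real ^ 'n::finite \<Rightarrow> real"
  shows "open S \<Longrightarrow> smooth_on S f \<Longrightarrow> smooth_on S g \<Longrightarrow> smooth_on S (\<lambda>x. f x * g x)"
  unfolding smooth_on_def by (simp add: Ck_on_mult)

lemma smooth_on_inverse:
  fixes f :: "real ^ 'n::finite \<Rightarrow> real"
  shows "open S \<Longrightarrow> smooth_on S f \<Longrightarrow> (\<And>x. x \<in> S \<Longrightarrow> f x \<noteq> 0) \<Longrightarrow>
    smooth_on S (\<lambda>x. inverse (f x))"
  unfolding smooth_on_def by (simp add: Ck_on_inverse)

lemma smooth_on_divide:
  fixes f g :: "real ^ 'n::finite \<Rightarrow> real"
  assumes "open S" "smooth_on S f" "smooth_on S g" "\<And>x. x \<in> S \<Longrightarrow> g x \<noteq> 0"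
  shows "smooth_on S (\<lambda>x. f x / g x)"
  unfolding divide_inverse using assms by (intro smooth_on_mult smooth_on_inverse)

lemma smooth_on_minus:
  fixes f :: "real ^ 'n::finite \<Rightarrow> real"
  assumes "open S" "smooth_on S f"
  shows "smooth_on S (\<lambda>x. - f x)"
  using smooth_on_mult[OF assms(1) smooth_on_const assms(2), of "-1"] by simp

lemma smooth_on_diff:
  fixes f g :: "real ^ 'n::finite \<Rightarrow> real"
  assumes "open S" "smooth_on S f" "smooth_on S g"
  shows "smooth_on S (\<lambda>x. f x - g x)"
  using smooth_on_add[OF assms(1,2) smooth_on_minus[OF assms(1,3)]] by simp

lemma smooth_on_sum:
  assumes "open S" "\<And>i. i \<in> I \<Longrightarrow> smooth_on S (f i)"
  shows "smooth_on S (\<lambda>x. \<Sum>i\<in>I. f i x)"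
proof (cases "finite I")
  case True
  then show ?thesis
    using assms(2) by (induction I) (auto intro!: smooth_on_const smooth_on_add \<open>open S\<close>)
qed (simp add: smooth_on_const)

lemma smooth_on_prod:
  fixes f :: "'i \<Rightarrow> real ^ 'n::finite \<Rightarrow> real"
  assumes "open S" "\<And>i. i \<in> I \<Longrightarrow> smooth_on S (f i)"
  shows "smooth_on S (\<lambda>x. \<Prod>i\<in>I. f i x)"
proof (cases "finite I")
  case True
  then show ?thesis
    using assms(2) by (induction I) (auto intro!: smooth_on_const smooth_on_mult \<open>open S\<close>)
qed (simp add: smooth_on_const)

lemma smooth_on_nth:
  fixes f :: "real ^ 'n::finite \<Rightarrow> real ^ 'm::finite"
  shows "open S \<Longrightarrow> smooth_on S f \<Longrightarrow> smooth_on S (\<lambda>x. f x $ j)"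
  unfolding smooth_on_def by (simp add: Ck_on_nth)

lemma smooth_on_det:
  fixes A :: "real ^ 'n::finite \<Rightarrow> real ^ 'm ^ 'm"
  assumes "open S" "\<And>i j. smooth_on S (\<lambda>x. A x $ i $ j)"
  shows "smooth_on S (\<lambda>x. det (A x))"
  unfolding det_def
  by (intro smooth_on_sum smooth_on_mult smooth_on_const smooth_on_prod assms)

lemma
  fixes A :: "real ^ 'n::finite ^ 'n"
  assumes "invertible A"
  shows matrix_inv_right: "A ** matrix_inv A = mat 1"
    and matrix_inv_left: "matrix_inv A ** A = mat 1"
  using assms someI_ex[of "\<lambda>A'. A ** A' = mat 1 \<and> A' ** A = mat 1"]
  unfolding invertible_def matrix_inv_def by auto

text \<open>Cramer's rule: column j of the inverse solves A v = e_j, so its entries are quotients of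
  determinants, and these are polynomial in the entries of A.\<close>

lemma smooth_on_matrix_inv:
  fixes A :: "real ^ 'n::finite \<Rightarrow> real ^ 'm ^ 'm"
  assumes "open S" and sm: "\<And>i j. smooth_on S (\<lambda>x. A x $ i $ j)"
    and inv: "\<And>x. x \<in> S \<Longrightarrow> invertible (A x)"
  shows "smooth_on S (\<lambda>x. matrix_inv (A x) $ i $ j)"
proof (rule smooth_on_cong[OF \<open>open S\<close>])
  let ?B = "\<lambda>x. (\<chi> k l. if l = i then axis j 1 $ k else A x $ k $ l)"
  have "smooth_on S (\<lambda>x. ?B x $ k $ l)" for k l
    by (cases "l = i") (auto intro: smooth_on_const sm)
  then show "smooth_on S (\<lambda>x. det (?B x) / det (A x))"
    using inv by (intro smooth_on_divide smooth_on_det sm \<open>open S\<close>) (auto simp: invertible_det_nz)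
  fix x assume x: "x \<in> S"
  have "A x ** matrix_inv (A x) = mat 1"
    using inv[OF x] by (rule matrix_inv_right)
  then have "A x *v (matrix_inv (A x) *v axis j 1) = axis j 1"
    by (simp add: matrix_vector_mul_assoc)
  then have "matrix_inv (A x) *v axis j 1 = (\<chi> k. det (\<chi> i l. if l = k then axis j 1 $ i else A x $ i $ l) / det (A x))"
    by (subst (asm) cramer) (use inv[OF x] in \<open>simp_all add: invertible_det_nz\<close>)
  then have "(matrix_inv (A x) *v axis j 1) $ i = det (?B x) / det (A x)"
    by (simp add: vec_eq_iff)
  then show "det (?B x) / det (A x) = matrix_inv (A x) $ i $ j"
    by (simp add: matrix_vector_mul_component inner_axis)
qed

section \<open>Symmetry of second partial derivatives\<close>

lemma has_real_derivative_along:
  fixes f :: "real ^ 'n::finite \<Rightarrow> real"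
  assumes "f differentiable at (x + t *\<^sub>R axis i 1)"
  shows "((\<lambda>s. f (x + s *\<^sub>R axis i 1)) has_real_derivative pd i f (x + t *\<^sub>R axis i 1)) (at t)"
proof -
  let ?D = "frechet_derivative f (at (x + t *\<^sub>R axis i 1))"
  have "((\<lambda>s. f (x + s *\<^sub>R axis i 1)) has_derivative (\<lambda>h. ?D (h *\<^sub>R axis i 1))) (at t)"
    using assms
    by (intro has_derivative_compose[of "\<lambda>s. x + s *\<^sub>R axis i 1" _ t UNIV f])
      (auto intro!: derivative_eq_intros simp: frechet_derivative_works)
  moreover have "(\<lambda>h. ?D (h *\<^sub>R axis i 1)) = (*) (pd i f (x + t *\<^sub>R axis i 1))"
    using linear_frechet_derivative[OF assms] by (auto simp: linear_scale pd_def fun_eq_iff)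
  ultimately show ?thesis by (simp add: has_field_derivative_def)
qed

text \<open>The mean value theorem is applied twice: in direction i to the difference of f between
  two parallel segments, then in direction j to \<open>pd i f\<close>. The left side is symmetric in
  i and j, which yields the symmetry of second derivatives.\<close>

lemma second_difference_mvt:
  fixes f :: "real ^ 'n::finite \<Rightarrow> real"
  assumes "\<And>y. y \<in> cball x (2 * h) \<Longrightarrow> f differentiable at y"
    and "\<And>y. y \<in> cball x (2 * h) \<Longrightarrow> pd i f differentiable at y" and "h > 0"
  obtains y where "y \<in> cball x (2 * h)"
    "f (x + h *\<^sub>R axis i 1 + h *\<^sub>R axis j 1) - f (x + h *\<^sub>R axis i 1) -
       f (x + h *\<^sub>R axis j 1) + f x = h * h * pd j (pd i f) y"
proof -
  let ?a = "axis i 1 :: real ^ 'n" and ?b = "axis j 1 :: real ^ 'n"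
  have near: "x + s *\<^sub>R ?a + t *\<^sub>R ?b \<in> cball x (2 * h)" if "0 \<le> s" "s \<le> h" "0 \<le> t" "t \<le> h" for s t
  proof -
    have "norm (s *\<^sub>R ?a + t *\<^sub>R ?b) \<le> norm (s *\<^sub>R ?a) + norm (t *\<^sub>R ?b)"
      by (rule norm_triangle_ineq)
    also have "\<dots> \<le> 2 * h" using that by (simp add: norm_axis_1)
    finally have "norm (- (s *\<^sub>R ?a + t *\<^sub>R ?b)) \<le> 2 * h" unfolding norm_minus_cancel .
    then show ?thesis by (simp add: dist_norm algebra_simps)
  qed
  let ?F = "\<lambda>s. f (x + h *\<^sub>R ?b + s *\<^sub>R ?a) - f (x + s *\<^sub>R ?a)"
  have "(?F has_real_derivative pd i f (x + h *\<^sub>R ?b + s *\<^sub>R ?a) - pd i f (x + s *\<^sub>R ?a)) (at s)"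
    if "0 \<le> s" "s \<le> h" for s
  proof (intro DERIV_diff has_real_derivative_along assms(1))
    show "x + h *\<^sub>R ?b + s *\<^sub>R ?a \<in> cball x (2 * h)"
      using near[of s h] that \<open>h > 0\<close> by (simp add: add_ac)
    show "x + s *\<^sub>R ?a \<in> cball x (2 * h)"
      using near[of s 0] that \<open>h > 0\<close> by simp
  qed
  then obtain s where s: "0 < s" "s < h"
    and Fs: "?F h - ?F 0 = (h - 0) * (pd i f (x + h *\<^sub>R ?b + s *\<^sub>R ?a) - pd i f (x + s *\<^sub>R ?a))"
    using MVT2[OF \<open>h > 0\<close>, of ?F
        "\<lambda>s. pd i f (x + h *\<^sub>R ?b + s *\<^sub>R ?a) - pd i f (x + s *\<^sub>R ?a)"] by auto
  let ?K = "\<lambda>t. pd i f (x + s *\<^sub>R ?a + t *\<^sub>R ?b)"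
  have "(?K has_real_derivative pd j (pd i f) (x + s *\<^sub>R ?a + t *\<^sub>R ?b)) (at t)"
    if "0 \<le> t" "t \<le> h" for t
    using s that by (intro has_real_derivative_along assms(2) near) simp_all
  then obtain t where t: "0 < t" "t < h"
    and Kt: "?K h - ?K 0 = (h - 0) * pd j (pd i f) (x + s *\<^sub>R ?a + t *\<^sub>R ?b)"
    using MVT2[OF \<open>h > 0\<close>, of ?K "\<lambda>t. pd j (pd i f) (x + s *\<^sub>R ?a + t *\<^sub>R ?b)"] by auto
  show thesis
  proof
    show "x + s *\<^sub>R ?a + t *\<^sub>R ?b \<in> cball x (2 * h)" using near s t by simp
    show "f (x + h *\<^sub>R ?a + h *\<^sub>R ?b) - f (x + h *\<^sub>R ?a) - f (x + h *\<^sub>R ?b) + f x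
        = h * h * pd j (pd i f) (x + s *\<^sub>R ?a + t *\<^sub>R ?b)"
      using Fs Kt by (simp add: add_ac)
  qed
qed

lemma pd_commute:
  fixes f :: "real ^ 'n::finite \<Rightarrow> real"
  assumes "open S" "x \<in> S" "smooth_on S f"
  shows "pd i (pd j f) x = pd j (pd i f) x"
proof (rule ccontr)
  let ?p = "pd j (pd i f)" and ?q = "pd i (pd j f)"
  assume "\<not> ?thesis"
  then have e: "dist (?q x) (?p x) / 2 > 0" (is "?e > 0") by simp
  have "continuous_on S ?p" "continuous_on S ?q"
    using assms by (auto intro!: smooth_on_continuous_on smooth_on_pd)
  then have "isCont ?p x" "isCont ?q x"
    using assms continuous_on_eq_continuous_at by blast+
  then obtain d1 d2 where d: "d1 > 0" "d2 > 0"
      "\<And>y. dist y x < d1 \<Longrightarrow> dist (?p y) (?p x) < ?e"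
      "\<And>y. dist y x < d2 \<Longrightarrow> dist (?q y) (?q x) < ?e"
    using e unfolding continuous_at_eps_delta by (metis dist_real_def)
  obtain d3 where d3: "d3 > 0" "cball x d3 \<subseteq> S"
    using assms open_contains_cball by blast
  \<comment> \<open>The intermediate points lie within 2h of x, so 2h has to stay below both
    continuity radii and inside the ball contained in S.\<close>
  define h where "h = min d1 (min d2 d3) / 4"
  have h: "h > 0" "2 * h < d1" "2 * h < d2" "2 * h \<le> d3" using d d3 by (auto simp: h_def)
  then have sub: "y \<in> S" if "y \<in> cball x (2 * h)" for y using that d3 by auto
  have diff: "f differentiable at y" "pd i f differentiable at y" "pd j f differentiable at y"
    if "y \<in> cball x (2 * h)" for y
    using sub[OF that] assms(3) by (auto intro: smooth_on_differentiable smooth_on_pd)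
  obtain y where y: "y \<in> cball x (2 * h)" "f (x + h *\<^sub>R axis i 1 + h *\<^sub>R axis j 1) - f (x + h *\<^sub>R axis i 1) -
       f (x + h *\<^sub>R axis j 1) + f x = h * h * ?p y"
    using second_difference_mvt[OF diff(1,2) h(1)] .
  obtain z where z: "z \<in> cball x (2 * h)" "f (x + h *\<^sub>R axis j 1 + h *\<^sub>R axis i 1) - f (x + h *\<^sub>R axis j 1) -
       f (x + h *\<^sub>R axis i 1) + f x = h * h * ?q z"
    using second_difference_mvt[OF diff(1,3) h(1)] .
  have "f (x + h *\<^sub>R axis i 1 + h *\<^sub>R axis j 1) = f (x + h *\<^sub>R axis j 1 + h *\<^sub>R axis i 1)"
    by (simp add: add_ac)
  then have "h * h * ?p y = h * h * ?q z" using y(2) z(2) by linarith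
  then have "?p y = ?q z" using h by simp
  moreover have "dist (?p y) (?p x) < ?e" "dist (?q z) (?q x) < ?e"
    using d(3)[of y] d(4)[of z] y z h by (auto simp: dist_commute)
  ultimately show False
    using dist_triangle[of "?q x" "?p x" "?q z"] by (simp add: dist_commute)
qed

subsection \<open>Matrix-valued functions\<close>

lemma matrix_add_rdistrib: "((A :: real ^ 'n ^ 'm) + B) ** C = A ** C + B ** C"
  by (vector matrix_matrix_mult_def sum.distrib[symmetric] algebra_simps)

lemma matrix_sub_ldistrib: "(A :: real ^ 'n ^ 'm) ** (B - C) = A ** B - A ** C"
  by (vector matrix_matrix_mult_def sum_subtractf[symmetric] algebra_simps)

lemma matrix_sub_rdistrib: "((A :: real ^ 'n ^ 'm) - B) ** C = A ** C - B ** C"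
  by (vector matrix_matrix_mult_def sum_subtractf[symmetric] algebra_simps)

lemma matrix_minus_left: "(- (A :: real ^ 'n ^ 'm)) ** B = - (A ** B)"
  by (vector matrix_matrix_mult_def sum_negf[symmetric])

lemma matrix_minus_right: "(A :: real ^ 'n ^ 'm) ** (- B) = - (A ** B)"
  by (vector matrix_matrix_mult_def sum_negf[symmetric])

lemmas matrix_ring_simps = matrix_add_ldistrib matrix_add_rdistrib matrix_sub_ldistrib
  matrix_sub_rdistrib matrix_minus_left matrix_minus_right matrix_mul_assoc

lemma transpose_add: "transpose ((A :: real ^ 'n ^ 'm) + B) = transpose A + transpose B"
  by (vector transpose_def)

lemma transpose_diff: "transpose ((A :: real ^ 'n ^ 'm) - B) = transpose A - transpose B"
  by (vector transpose_def)

text \<open>Whole matrices replace indices wherever possible: the curvature identities below become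
  identities in a noncommutative ring, with \<open>mpd\<close> acting as a derivation.\<close>

definition mpd :: "'n::finite \<Rightarrow> (real ^ 'n \<Rightarrow> real ^ 'm ^ 'm) \<Rightarrow> real ^ 'n \<Rightarrow> real ^ 'm ^ 'm"
  where "mpd i A x = (\<chi> l k. pd i (\<lambda>y. A y $ l $ k) x)"

definition smooth_mat :: "(real ^ 'n::finite) set \<Rightarrow> (real ^ 'n \<Rightarrow> real ^ 'm::finite ^ 'm) \<Rightarrow> bool"
  where "smooth_mat S A \<longleftrightarrow> (\<forall>l k. smooth_on S (\<lambda>x. A x $ l $ k))"

context
  fixes S :: "(real ^ 'n::finite) set"
  assumes S: "open S"
begin

lemma smooth_mat_nth: "smooth_mat S A \<Longrightarrow> smooth_on S (\<lambda>x. A x $ l $ k)"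
  by (simp add: smooth_mat_def)

lemma smooth_mat_differentiable:
  "smooth_mat S A \<Longrightarrow> x \<in> S \<Longrightarrow> (\<lambda>x. A x $ l $ k) differentiable at x"
  unfolding smooth_mat_def using smooth_on_differentiable by blast

lemma smooth_mat_mpd: "smooth_mat S A \<Longrightarrow> smooth_mat S (mpd i A)"
  by (simp add: smooth_mat_def mpd_def smooth_on_pd)

lemma smooth_mat_add: "smooth_mat S A \<Longrightarrow> smooth_mat S B \<Longrightarrow> smooth_mat S (\<lambda>x. A x + B x)"
  by (simp add: smooth_mat_def smooth_on_add S)

lemma smooth_mat_diff: "smooth_mat S A \<Longrightarrow> smooth_mat S B \<Longrightarrow> smooth_mat S (\<lambda>x. A x - B x)"
  by (simp add: smooth_mat_def smooth_on_diff S)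

lemma smooth_mat_uminus: "smooth_mat S A \<Longrightarrow> smooth_mat S (\<lambda>x. - A x)"
  by (simp add: smooth_mat_def smooth_on_minus S)

lemma smooth_mat_transpose: "smooth_mat S A \<Longrightarrow> smooth_mat S (\<lambda>x. transpose (A x))"
  by (simp add: smooth_mat_def transpose_def)

lemma smooth_mat_mult: "smooth_mat S A \<Longrightarrow> smooth_mat S B \<Longrightarrow> smooth_mat S (\<lambda>x. A x ** B x)"
  by (simp add: smooth_mat_def matrix_matrix_mult_def smooth_on_sum smooth_on_mult S)

lemma mpd_cong: "(\<And>x. x \<in> S \<Longrightarrow> A x = B x) \<Longrightarrow> x \<in> S \<Longrightarrow> mpd i A x = mpd i B x"
  by (auto simp: mpd_def vec_eq_iff intro!: pd_cong_open[OF S])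

lemma mpd_const: "mpd i (\<lambda>x. C) x = 0"
  by (simp add: mpd_def vec_eq_iff)

lemma mpd_transpose: "mpd i (\<lambda>x. transpose (A x)) x = transpose (mpd i A x)"
  by (simp add: mpd_def vec_eq_iff transpose_def)

context
  fixes A B :: "real ^ 'n \<Rightarrow> real ^ 'm::finite ^ 'm" and x
  assumes A: "smooth_mat S A" and B: "smooth_mat S B" and x: "x \<in> S"
begin

lemma mpd_add: "mpd i (\<lambda>x. A x + B x) x = mpd i A x + mpd i B x"
  by (simp add: mpd_def vec_eq_iff pd_add smooth_mat_differentiable A B x)

lemma mpd_diff: "mpd i (\<lambda>x. A x - B x) x = mpd i A x - mpd i B x"
  by (simp add: mpd_def vec_eq_iff pd_diff smooth_mat_differentiable A B x)

lemma mpd_mult: "mpd i (\<lambda>x. A x ** B x) x = mpd i A x ** B x + A x ** mpd i B x"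
  by (simp add: mpd_def vec_eq_iff matrix_matrix_mult_def pd_sum pd_mult differentiable_mult
      smooth_mat_differentiable A B x sum.distrib)

end

lemma mpd_commute: "smooth_mat S A \<Longrightarrow> x \<in> S \<Longrightarrow> mpd i (mpd j A) x = mpd j (mpd i A) x"
  by (simp add: mpd_def vec_eq_iff smooth_mat_def pd_commute[OF S])

lemma mpd_uminus: "smooth_mat S A \<Longrightarrow> x \<in> S \<Longrightarrow> mpd i (\<lambda>x. - A x) x = - mpd i A x"
  by (simp add: mpd_def vec_eq_iff pd_minus smooth_mat_differentiable)

end

subsection \<open>Curvature in coordinates\<close>

text \<open>Here \<open>s i j\<close> stands for $R^{lk}{}_{ij}$ and
  \<open>d m i j\<close> for its partial derivative in direction \<open>m\<close>.\<close>

lemma contracted_bianchi_algebra: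
  fixes s :: "'n::finite \<Rightarrow> 'n \<Rightarrow> real ^ 'n ^ 'n" and d :: "'n \<Rightarrow> 'n \<Rightarrow> 'n \<Rightarrow> real ^ 'n ^ 'n"
    and \<gamma> :: "'n \<Rightarrow> real ^ 'n ^ 'n"
  assumes s1: "\<And>i j. s j i = - s i j" and s2: "\<And>i j l k. s i j $ k $ l = - s i j $ l $ k"
    and d1: "\<And>m i j. d m j i = - d m i j" and d2: "\<And>m i j l k. d m i j $ k $ l = - d m i j $ l $ k"
    and tf: "\<And>i l k. \<gamma> i $ l $ k = \<gamma> k $ l $ i"
    and bianchi: "\<And>m i j. (d m i j + \<gamma> m ** s i j + s i j ** transpose (\<gamma> m)) +
       (d i j m + \<gamma> i ** s j m + s j m ** transpose (\<gamma> i)) +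
       (d j m i + \<gamma> j ** s m i + s m i ** transpose (\<gamma> j)) = 0"
  shows "(\<Sum>i\<in>UNIV. \<Sum>j\<in>UNIV. d m i j $ i $ j) =
    2 * ((\<Sum>i\<in>UNIV. \<Sum>j\<in>UNIV. d i j m $ j $ i) +
         (\<Sum>i\<in>UNIV. \<Sum>a\<in>UNIV. \<gamma> i $ i $ a * (\<Sum>j\<in>UNIV. s j m $ j $ a)) -
         (\<Sum>i\<in>UNIV. \<Sum>a\<in>UNIV. \<gamma> m $ i $ a * (\<Sum>j\<in>UNIV. s j i $ j $ a)))"
proof -
  \<comment> \<open>\<open>T\<close> is the covariant derivative with the Christoffel terms for the
    upper index pair only. Those for the lower pair i, j cancel in the cyclic sum because the
    connection is torsion-free.\<close>
  define T where "T m i j = d m i j + \<gamma> m ** s i j + s i j ** transpose (\<gamma> m)" for m i j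
  have T: "T m i j $ l $ k = d m i j $ l $ k + (\<Sum>a\<in>UNIV. \<gamma> m $ l $ a * s i j $ a $ k) +
      (\<Sum>a\<in>UNIV. s i j $ l $ a * \<gamma> m $ k $ a)" for m i j l k
    by (simp add: T_def matrix_matrix_mult_def transpose_def)
  have T1: "T m j i $ l $ k = - T m i j $ l $ k" for m i j l k
    unfolding T by (simp add: s1[of j i] d1[of m j i] sum_negf)
  have T2: "T m i j $ k $ l = - T m i j $ l $ k" for m i j l k
  proof -
    have "(\<Sum>a\<in>UNIV. \<gamma> m $ k $ a * s i j $ a $ l) = - (\<Sum>a\<in>UNIV. s i j $ l $ a * \<gamma> m $ k $ a)" for k l
      unfolding sum_negf[symmetric] by (rule sum.cong) (simp_all add: s2[of i j _ l])
    then show ?thesis unfolding T by (simp add: d2[of m i j k l])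
  qed
  have "T m i j + T i j m + T j m i = 0" for i j
    using bianchi[of m i j] by (simp add: T_def)
  then have "(\<Sum>i\<in>UNIV. \<Sum>j\<in>UNIV. T m i j $ i $ j + T i j m $ i $ j + T j m i $ i $ j) = 0"
    by (simp add: vec_eq_iff)
  then have sum0: "(\<Sum>i\<in>UNIV. \<Sum>j\<in>UNIV. T m i j $ i $ j) + (\<Sum>i\<in>UNIV. \<Sum>j\<in>UNIV. T i j m $ i $ j) +
      (\<Sum>i\<in>UNIV. \<Sum>j\<in>UNIV. T j m i $ i $ j) = 0"
    by (simp add: sum.distrib)
  \<comment> \<open>Swapping both antisymmetric pairs shows that the second and third contractions
    of the Bianchi identity agree; this is the factor 2 in the conclusion.\<close>
  have "(\<Sum>i\<in>UNIV. \<Sum>j\<in>UNIV. T j m i $ i $ j) = (\<Sum>i\<in>UNIV. \<Sum>j\<in>UNIV. T j i m $ j $ i)"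
    by (intro sum.cong refl) (use T1 T2 in \<open>metis minus_minus\<close>)
  also have "\<dots> = (\<Sum>i\<in>UNIV. \<Sum>j\<in>UNIV. T i j m $ i $ j)"
    by (rule sum.swap)
  finally have A3: "(\<Sum>i\<in>UNIV. \<Sum>j\<in>UNIV. T j m i $ i $ j) = (\<Sum>i\<in>UNIV. \<Sum>j\<in>UNIV. T i j m $ i $ j)" .
  let ?g = "\<Sum>i\<in>UNIV. \<Sum>a\<in>UNIV. \<gamma> m $ i $ a * (\<Sum>j\<in>UNIV. s j i $ j $ a)"
  have g1: "(\<Sum>i\<in>UNIV. \<Sum>j\<in>UNIV. \<Sum>a\<in>UNIV. s i j $ i $ a * \<gamma> m $ j $ a) = ?g"
  proof -
    have "(\<Sum>i\<in>UNIV. \<Sum>j\<in>UNIV. \<Sum>a\<in>UNIV. s i j $ i $ a * \<gamma> m $ j $ a) =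
        (\<Sum>j\<in>UNIV. \<Sum>i\<in>UNIV. \<Sum>a\<in>UNIV. s i j $ i $ a * \<gamma> m $ j $ a)"
      by (rule sum.swap)
    also have "\<dots> = (\<Sum>j\<in>UNIV. \<Sum>a\<in>UNIV. \<Sum>i\<in>UNIV. s i j $ i $ a * \<gamma> m $ j $ a)"
      by (intro sum.cong refl sum.swap)
    finally show ?thesis by (simp add: sum_distrib_left mult.commute)
  qed
  have g2: "(\<Sum>i\<in>UNIV. \<Sum>j\<in>UNIV. \<Sum>a\<in>UNIV. \<gamma> m $ i $ a * s i j $ a $ j) = ?g"
  proof -
    have "(\<Sum>j\<in>UNIV. \<Sum>a\<in>UNIV. \<gamma> m $ i $ a * s i j $ a $ j) =
        (\<Sum>a\<in>UNIV. \<gamma> m $ i $ a * (\<Sum>j\<in>UNIV. s j i $ j $ a))" for i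
    proof -
      have "(\<Sum>j\<in>UNIV. \<Sum>a\<in>UNIV. \<gamma> m $ i $ a * s i j $ a $ j) =
          (\<Sum>a\<in>UNIV. \<Sum>j\<in>UNIV. \<gamma> m $ i $ a * s i j $ a $ j)" by (rule sum.swap)
      also have "s i j $ a $ j = s j i $ j $ a" for a j
        using s1[of j i] s2[of i j a j] by simp
      then have "(\<Sum>a\<in>UNIV. \<Sum>j\<in>UNIV. \<gamma> m $ i $ a * s i j $ a $ j) =
          (\<Sum>a\<in>UNIV. \<gamma> m $ i $ a * (\<Sum>j\<in>UNIV. s j i $ j $ a))"
        by (simp add: sum_distrib_left)
      finally show ?thesis .
    qed
    then show ?thesis by simp
  qed
  have A1: "(\<Sum>i\<in>UNIV. \<Sum>j\<in>UNIV. T m i j $ i $ j) = (\<Sum>i\<in>UNIV. \<Sum>j\<in>UNIV. d m i j $ i $ j) + 2 * ?g"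
    unfolding T sum.distrib g1 g2 by simp
  let ?h = "\<Sum>i\<in>UNIV. \<Sum>a\<in>UNIV. \<gamma> i $ i $ a * (\<Sum>j\<in>UNIV. s j m $ j $ a)"
  have h1: "(\<Sum>i\<in>UNIV. \<Sum>j\<in>UNIV. \<Sum>a\<in>UNIV. \<gamma> i $ i $ a * s j m $ a $ j) = - ?h"
  proof -
    have "(\<Sum>j\<in>UNIV. \<Sum>a\<in>UNIV. \<gamma> i $ i $ a * s j m $ a $ j) =
        (\<Sum>a\<in>UNIV. \<Sum>j\<in>UNIV. \<gamma> i $ i $ a * s j m $ a $ j)" for i
      by (rule sum.swap)
    moreover have "(\<Sum>j\<in>UNIV. \<gamma> i $ i $ a * s j m $ a $ j) =
        - (\<gamma> i $ i $ a * (\<Sum>j\<in>UNIV. s j m $ j $ a))" for i a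
      unfolding sum_distrib_left sum_negf[symmetric]
      by (rule sum.cong) (simp_all add: s2[of _ m a])
    ultimately show ?thesis by (simp add: sum_negf)
  qed
  \<comment> \<open>The summand pairs \<open>s\<close>, antisymmetric in i and a, with
    \<open>\<gamma>\<close>, symmetric in i and a.\<close>
  have h2: "(\<Sum>i\<in>UNIV. \<Sum>j\<in>UNIV. \<Sum>a\<in>UNIV. s j m $ i $ a * \<gamma> i $ j $ a) = 0" (is "?z = 0")
  proof -
    have "?z = (\<Sum>j\<in>UNIV. \<Sum>i\<in>UNIV. \<Sum>a\<in>UNIV. s j m $ i $ a * \<gamma> i $ j $ a)"
      by (rule sum.swap)
    moreover have "(\<Sum>i\<in>UNIV. \<Sum>a\<in>UNIV. s j m $ i $ a * \<gamma> i $ j $ a) = 0" (is "?w = 0") for j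
    proof -
      have "?w = (\<Sum>a\<in>UNIV. \<Sum>i\<in>UNIV. s j m $ i $ a * \<gamma> i $ j $ a)" by (rule sum.swap)
      also have "\<dots> = (\<Sum>a\<in>UNIV. \<Sum>i\<in>UNIV. - (s j m $ a $ i * \<gamma> a $ j $ i))"
        by (intro sum.cong refl) (metis s2 tf minus_mult_left)
      also have "\<dots> = - ?w" by (simp add: sum_negf)
      finally show ?thesis by simp
    qed
    ultimately show ?thesis by simp
  qed
  have A2: "(\<Sum>i\<in>UNIV. \<Sum>j\<in>UNIV. T i j m $ i $ j) = - (\<Sum>i\<in>UNIV. \<Sum>j\<in>UNIV. d i j m $ j $ i) - ?h"
  proof -
    have "(\<Sum>i\<in>UNIV. \<Sum>j\<in>UNIV. d i j m $ i $ j) = - (\<Sum>i\<in>UNIV. \<Sum>j\<in>UNIV. d i j m $ j $ i)"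
      unfolding sum_negf[symmetric] by (intro sum.cong refl) (rule d2)
    then show ?thesis unfolding T sum.distrib h1 h2 by simp
  qed
  show ?thesis using sum0 unfolding A1 A2 A3 by (simp add: algebra_simps)
qed

section \<open>Connection and curvature of a metric in coordinates\<close>

locale riemannian_coords =
  fixes U :: "(real ^ 'n::finite) set" and G :: "real ^ 'n \<Rightarrow> real ^ 'n ^ 'n"
  assumes open_U: "open U"
    and smooth_G: "smooth_mat U G"
    and sym_G: "x \<in> U \<Longrightarrow> transpose (G x) = G x"
    and pos_G: "x \<in> U \<Longrightarrow> v \<noteq> 0 \<Longrightarrow> v \<bullet> (G x *v v) > 0"
begin

definition H :: "real ^ 'n \<Rightarrow> real ^ 'n ^ 'n"
  where "H x = matrix_inv (G x)"

text \<open>The connection matrix in direction i: on vector fields the covariant derivative is the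
  partial derivative plus \<open>Gam i\<close>. The curvature \<open>Rm\<close> then takes the form
  dA + A A of a matrix-valued connection form.\<close>

definition Gam :: "'n \<Rightarrow> real ^ 'n \<Rightarrow> real ^ 'n ^ 'n"
  where "Gam i x = (\<chi> l k. christoffel G l i k x)"

definition Rm :: "'n \<Rightarrow> 'n \<Rightarrow> real ^ 'n \<Rightarrow> real ^ 'n ^ 'n"
  where "Rm i j x = mpd i (Gam j) x - mpd j (Gam i) x + (Gam i x ** Gam j x - Gam j x ** Gam i x)"

definition Ric :: "real ^ 'n \<Rightarrow> real ^ 'n ^ 'n"
  where "Ric x = (\<chi> k j. ricci G k j x)"

text \<open>$R^{lk}{}_{ij}$ and the mixed Ricci tensor $R^j{}_m$.\<close>

definition S :: "'n \<Rightarrow> 'n \<Rightarrow> real ^ 'n \<Rightarrow> real ^ 'n ^ 'n"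
  where "S i j x = Rm i j x ** H x"

definition P :: "real ^ 'n \<Rightarrow> real ^ 'n ^ 'n"
  where "P x = (\<chi> j m. \<Sum>i\<in>UNIV. S i m x $ i $ j)"

lemma invertible_G: "x \<in> U \<Longrightarrow> invertible (G x)"
  unfolding invertible_left_inverse matrix_left_invertible_ker
  using pos_G by fastforce

lemma G_H: "x \<in> U \<Longrightarrow> G x ** H x = mat 1"
  unfolding H_def by (rule matrix_inv_right[OF invertible_G])

lemma H_G: "x \<in> U \<Longrightarrow> H x ** G x = mat 1"
  unfolding H_def by (rule matrix_inv_left[OF invertible_G])

lemma sym_H: "x \<in> U \<Longrightarrow> transpose (H x) = H x"
proof -
  assume x: "x \<in> U"
  have "transpose (H x) ** G x = mat 1"
    using arg_cong[OF G_H[OF x], of transpose] by (simp add: matrix_transpose_mul sym_G x)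
  then have "transpose (H x) ** (G x ** H x) = H x"
    by (simp add: matrix_mul_assoc)
  then show ?thesis by (simp add: G_H x)
qed

lemma smooth_H: "smooth_mat U H"
  unfolding smooth_mat_def H_def
  by (intro allI smooth_on_matrix_inv open_U invertible_G)
    (use smooth_G in \<open>auto simp: smooth_mat_def\<close>)

lemma smooth_Gam: "smooth_mat U (Gam i)"
proof -
  have "smooth_on U (\<lambda>x. christoffel G l i k x)" for l k
    unfolding christoffel_def H_def[symmetric]
    by (intro smooth_on_divide smooth_on_sum smooth_on_mult smooth_on_diff smooth_on_add
        smooth_on_pd smooth_on_const open_U smooth_mat_nth[OF open_U smooth_H]
        smooth_mat_nth[OF open_U smooth_G]) simp
  then show ?thesis by (simp add: smooth_mat_def Gam_def)
qed

lemma smooth_Rm: "smooth_mat U (Rm i j)"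
  unfolding Rm_def[abs_def]
  by (intro smooth_mat_add smooth_mat_diff smooth_mat_mult smooth_mat_mpd smooth_Gam open_U)

lemma smooth_S: "smooth_mat U (S i j)"
  unfolding S_def[abs_def] by (intro smooth_mat_mult smooth_Rm smooth_H open_U)

lemma smooth_P: "smooth_mat U P"
  unfolding smooth_mat_def P_def using smooth_mat_nth[OF open_U smooth_S]
  by (auto intro!: smooth_on_sum open_U)

lemma pd_G_sym: "x \<in> U \<Longrightarrow> pd m (\<lambda>y. G y $ i $ j) x = pd m (\<lambda>y. G y $ j $ i) x"
  by (rule pd_cong_open[OF open_U]) (use sym_G in \<open>auto simp: transpose_def vec_eq_iff\<close>)

lemma Gam_swap: "x \<in> U \<Longrightarrow> Gam i x $ l $ k = Gam k x $ l $ i"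
  by (simp add: Gam_def christoffel_def pd_G_sym[of x _ i k] add.commute)

lemma G_Gam:
  assumes "x \<in> U"
  shows "(G x ** Gam m x) $ i $ j =
    (pd m (\<lambda>y. G y $ j $ i) x + pd j (\<lambda>y. G y $ m $ i) x - pd i (\<lambda>y. G y $ m $ j) x) / 2"
proof -
  define K where "K = (\<chi> l. (pd m (\<lambda>y. G y $ j $ l) x + pd j (\<lambda>y. G y $ m $ l) x - pd l (\<lambda>y. G y $ m $ j) x))"
  have "(\<chi> c. Gam m x $ c $ j) = (1/2) *\<^sub>R (H x *v K)"
    by (simp add: vec_eq_iff Gam_def christoffel_def H_def K_def matrix_vector_mult_def)
  then have "G x *v (\<chi> c. Gam m x $ c $ j) = (1/2) *\<^sub>R (G x *v (H x *v K))"
    by (simp add: matrix_vector_mult_scaleR)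
  also have "\<dots> = (1/2) *\<^sub>R K"
    by (simp add: matrix_vector_mul_assoc G_H assms)
  finally have "(G x *v (\<chi> c. Gam m x $ c $ j)) $ i = K $ i / 2" by simp
  then show ?thesis
    by (simp add: K_def matrix_matrix_mult_def matrix_vector_mult_def)
qed

text \<open>Metric compatibility. \<open>G ** Gam m\<close> consists of the Christoffel symbols of
  the first kind, and in its sum with its transpose all but the m-th derivative of G
  cancels.\<close>

lemma mpd_G:
  assumes "x \<in> U"
  shows "mpd m G x = transpose (Gam m x) ** G x + G x ** Gam m x"
proof -
  have "transpose (Gam m x) ** G x = transpose (G x ** Gam m x)"
    by (simp add: matrix_transpose_mul sym_G assms)
  then show ?thesis
    by (simp add: vec_eq_iff transpose_def[of "G x ** Gam m x"] G_Gam assms mpd_def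
        pd_G_sym[OF assms, of m] pd_G_sym[OF assms, of _ m] field_simps)
qed

lemma mpd_H:
  assumes "x \<in> U"
  shows "mpd m H x = - (Gam m x ** H x) - H x ** transpose (Gam m x)"
proof -
  have "mpd m (\<lambda>y. G y ** H y) x = mpd m (\<lambda>y. mat 1) x"
    by (rule mpd_cong[OF open_U]) (simp_all add: G_H assms)
  then have "mpd m G x ** H x + G x ** mpd m H x = 0"
    by (simp add: mpd_mult[OF open_U smooth_G smooth_H assms] mpd_const[OF open_U])
  then have "H x ** (G x ** mpd m H x) = - (H x ** (mpd m G x ** H x))"
    by (metis add.inverse_unique add.commute matrix_minus_right)
  moreover have "H x ** (G x ** mpd m H x) = mpd m H x"
    by (simp add: matrix_mul_assoc H_G assms)
  moreover have "H x ** (mpd m G x ** H x) = H x ** transpose (Gam m x) ** (G x ** H x) +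
      (H x ** G x) ** Gam m x ** H x"
    by (simp add: mpd_G[OF assms] matrix_ring_simps)
  ultimately show ?thesis by (simp add: G_H H_G assms)
qed

lemma Rm_swap: "Rm j i x = - Rm i j x"
  by (simp add: Rm_def)

lemma S_swap: "S j i x = - S i j x"
  by (simp add: S_def Rm_swap[of j i] matrix_minus_left)

text \<open>The inverse metric is parallel as well (\<open>mpd_H\<close>), so commuting two
  derivatives of H leaves exactly Rm H + H Rm^T = 0.\<close>

lemma transpose_S:
  assumes x: "x \<in> U"
  shows "transpose (S i j x) = - S i j x"
proof -
  have 2: "mpd i (mpd j H) x =
     - (mpd i (Gam j) x ** H x + Gam j x ** mpd i H x) -
     (mpd i H x ** transpose (Gam j x) + H x ** transpose (mpd i (Gam j) x))" for i j
  proof -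
    have "mpd i (mpd j H) x = mpd i (\<lambda>y. - (Gam j y ** H y) - H y ** transpose (Gam j y)) x"
      by (rule mpd_cong[OF open_U]) (simp_all add: mpd_H x)
    then show ?thesis
      by (simp add: mpd_diff[OF open_U] mpd_uminus[OF open_U] mpd_mult[OF open_U]
          mpd_transpose[OF open_U] smooth_mat_mult smooth_mat_uminus smooth_mat_transpose smooth_H
          smooth_Gam open_U x)
  qed
  have "mpd i (mpd j H) x = mpd j (mpd i H) x"
    by (rule mpd_commute[OF open_U smooth_H x])
  then have "Rm i j x ** H x + H x ** transpose (Rm i j x) = 0"
    unfolding 2 mpd_H[OF x] Rm_def
    by (simp add: matrix_ring_simps transpose_add transpose_diff matrix_transpose_mul algebra_simps)
  then show ?thesis
    unfolding S_def by (simp add: matrix_transpose_mul sym_H x add_eq_0_iff)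
qed

lemma S_swap_upper: "x \<in> U \<Longrightarrow> S i j x $ k $ l = - S i j x $ l $ k"
  using arg_cong[OF transpose_S, of x "\<lambda>A. A $ l $ k" i j] by (simp add: transpose_def)

text \<open>All terms cancel in pairs by the symmetry of the Christoffel symbols in their lower
  indices.\<close>

lemma first_bianchi:
  assumes x: "x \<in> U"
  shows "Rm i j x $ l $ k + Rm j k x $ l $ i + Rm k i x $ l $ j = 0"
proof -
  have "mpd a (Gam b) x $ l $ c = mpd a (Gam c) x $ l $ b" for a b c
    unfolding mpd_def by (simp add: pd_cong_open[OF open_U x Gam_swap[of _ b _ c]])
  moreover have "(Gam a x ** Gam b x) $ l $ c = (Gam a x ** Gam c x) $ l $ b" for a b c
    unfolding matrix_matrix_mult_def by (simp add: Gam_swap[OF x, of b _ c])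
  ultimately show ?thesis unfolding Rm_def by simp
qed

lemma second_bianchi_S:
  assumes x: "x \<in> U"
  shows "(mpd m (S i j) x + Gam m x ** S i j x + S i j x ** transpose (Gam m x)) +
       (mpd i (S j m) x + Gam i x ** S j m x + S j m x ** transpose (Gam i x)) +
       (mpd j (S m i) x + Gam j x ** S m i x + S m i x ** transpose (Gam j x)) = 0"
proof -
  \<comment> \<open>\<open>D\<close> differentiates \<open>Rm\<close> covariantly as an endomorphism
    only. Its cyclic sum vanishes by commuting derivatives of \<open>Gam\<close>, and multiplying by
    H raises the index because H is parallel.\<close>
  define D where "D m i j = mpd m (Rm i j) x + Gam m x ** Rm i j x - Rm i j x ** Gam m x" for m i j
  have mR: "mpd m (Rm i j) x = mpd m (mpd i (Gam j)) x - mpd m (mpd j (Gam i)) x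
      + ((mpd m (Gam i) x ** Gam j x + Gam i x ** mpd m (Gam j) x) -
         (mpd m (Gam j) x ** Gam i x + Gam j x ** mpd m (Gam i) x))" for m i j
    unfolding Rm_def[abs_def]
    by (simp add: mpd_add[OF open_U] mpd_diff[OF open_U] mpd_mult[OF open_U] smooth_mat_mult
        smooth_mat_diff smooth_mat_mpd smooth_Gam open_U x)
  note comm = mpd_commute[OF open_U smooth_Gam x]
  have D0: "D m i j + D i j m + D j m i = 0"
    unfolding D_def mR Rm_def comm[of m i] comm[of j i] comm[of j m]
    by (simp add: matrix_ring_simps algebra_simps)
  have "mpd m (S i j) x + Gam m x ** S i j x + S i j x ** transpose (Gam m x) = D m i j ** H x"
    for m i j
    unfolding D_def S_def[abs_def] mpd_mult[OF open_U smooth_Rm smooth_H x] mpd_H[OF x]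
    by (simp add: matrix_ring_simps algebra_simps)
  then show ?thesis
    using arg_cong[OF D0, of "\<lambda>A. A ** H x"] by (simp add: matrix_add_rdistrib)
qed

lemma Rm_nth: "Rm i j x $ l $ k = riemann G l k i j x"
  by (simp add: Rm_def riemann_def mpd_def Gam_def matrix_matrix_mult_def sum_subtractf)

lemma Ric_nth: "Ric x $ k $ j = (\<Sum>i\<in>UNIV. Rm i j x $ i $ k)"
  by (simp add: Ric_def ricci_def Rm_nth)

lemma P_eq:
  assumes "x \<in> U"
  shows "P x = H x ** Ric x"
proof -
  have "P x $ j $ m = (H x ** Ric x) $ j $ m" for j m
  proof -
    have "P x $ j $ m = (\<Sum>i\<in>UNIV. \<Sum>k\<in>UNIV. Rm i m x $ i $ k * H x $ k $ j)"
      by (simp add: P_def S_def matrix_matrix_mult_def)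
    also have "\<dots> = (\<Sum>k\<in>UNIV. \<Sum>i\<in>UNIV. Rm i m x $ i $ k * H x $ k $ j)"
      by (rule sum.swap)
    also have "\<dots> = (\<Sum>k\<in>UNIV. Ric x $ k $ m * H x $ j $ k)"
      using sym_H[OF assms]
      by (simp add: Ric_nth sum_distrib_right transpose_def vec_eq_iff)
    finally show ?thesis by (simp add: matrix_matrix_mult_def mult.commute)
  qed
  then show ?thesis by (simp add: vec_eq_iff)
qed

text \<open>By the first Bianchi identity the antisymmetric part of Ricci is, up to sign, the trace
  of the endomorphism \<open>Rm j k\<close>. That trace pairs the antisymmetric \<open>S j k\<close>
  with the symmetric G.\<close>

lemma transpose_Ric:
  assumes x: "x \<in> U"
  shows "transpose (Ric x) = Ric x"
proof -
  have tr: "(\<Sum>i\<in>UNIV. Rm j k x $ i $ i) = 0" for j k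
  proof -
    have "Rm j k x = S j k x ** G x"
      by (simp add: S_def matrix_mul_assoc[symmetric] H_G x)
    then have "(\<Sum>i\<in>UNIV. Rm j k x $ i $ i) = (\<Sum>i\<in>UNIV. \<Sum>a\<in>UNIV. S j k x $ i $ a * G x $ a $ i)"
      (is "?t = _") by (simp add: matrix_matrix_mult_def)
    also have "\<dots> = (\<Sum>a\<in>UNIV. \<Sum>i\<in>UNIV. S j k x $ i $ a * G x $ a $ i)"
      by (rule sum.swap)
    also have "\<dots> = (\<Sum>a\<in>UNIV. \<Sum>i\<in>UNIV. - (S j k x $ a $ i * G x $ i $ a))"
    proof (intro sum.cong refl)
      fix a i
      have "G x $ a $ i = G x $ i $ a"
        using sym_G[OF x] by (simp add: transpose_def vec_eq_iff)
      then show "S j k x $ i $ a * G x $ a $ i = - (S j k x $ a $ i * G x $ i $ a)"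
        by (simp add: S_swap_upper[OF x, of j k i a])
    qed
    also have "\<dots> = - ?t"
      using \<open>?t = _\<close> by (simp add: sum_negf)
    finally show ?thesis by simp
  qed
  have "Ric x $ k $ j - Ric x $ j $ k = - (\<Sum>i\<in>UNIV. Rm j k x $ i $ i)" for j k
  proof -
    have "Rm i j x $ i $ k - Rm i k x $ i $ j = - Rm j k x $ i $ i" for i
      using first_bianchi[OF x, of i j i k] Rm_swap[of k i x] by simp
    then show ?thesis
      unfolding Ric_nth sum_subtractf[symmetric] sum_negf[symmetric] by simp
  qed
  then show ?thesis
    by (simp add: vec_eq_iff transpose_def tr)
qed

lemma scalar_coord_eq_S: "scalar_coord G x = (\<Sum>i\<in>UNIV. \<Sum>j\<in>UNIV. S i j x $ i $ j)"
proof -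
  have "(\<Sum>i\<in>UNIV. \<Sum>j\<in>UNIV. S i j x $ i $ j) =
      (\<Sum>i\<in>UNIV. \<Sum>j\<in>UNIV. \<Sum>k\<in>UNIV. Rm i j x $ i $ k * H x $ k $ j)"
    by (simp add: S_def matrix_matrix_mult_def)
  also have "\<dots> = (\<Sum>i\<in>UNIV. \<Sum>k\<in>UNIV. \<Sum>j\<in>UNIV. Rm i j x $ i $ k * H x $ k $ j)"
    by (intro sum.cong refl sum.swap)
  also have "\<dots> = (\<Sum>k\<in>UNIV. \<Sum>i\<in>UNIV. \<Sum>j\<in>UNIV. Rm i j x $ i $ k * H x $ k $ j)"
    by (rule sum.swap)
  also have "\<dots> = (\<Sum>k\<in>UNIV. \<Sum>j\<in>UNIV. \<Sum>i\<in>UNIV. Rm i j x $ i $ k * H x $ k $ j)"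
    by (intro sum.cong refl sum.swap)
  also have "\<dots> = scalar_coord G x"
    by (simp add: scalar_coord_def ricci_def Rm_nth H_def sum_distrib_left mult.commute)
  finally show ?thesis by simp
qed

lemma scalar_coord_eq_trace_P: "scalar_coord G x = (\<Sum>j\<in>UNIV. P x $ j $ j)"
  unfolding scalar_coord_eq_S P_def by (simp, rule sum.swap)

lemma smooth_scalar: "smooth_on U (scalar_coord G)"
  unfolding scalar_coord_eq_trace_P[abs_def]
  by (intro smooth_on_sum smooth_mat_nth open_U smooth_P)

text \<open>This is dR = 2 div Ric: the bracket is the covariant divergence
  \<open>nabla_i P^i_m\<close> of the mixed Ricci tensor, written out in coordinates.\<close>

lemma contracted_bianchi:
  assumes x: "x \<in> U"
  shows "pd m (scalar_coord G) x = 2 * ((\<Sum>i\<in>UNIV. pd i (\<lambda>y. P y $ i $ m) x) +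
     (\<Sum>i\<in>UNIV. \<Sum>a\<in>UNIV. Gam i x $ i $ a * P x $ a $ m) -
     (\<Sum>i\<in>UNIV. \<Sum>a\<in>UNIV. Gam m x $ i $ a * P x $ a $ i))"
proof -
  have dS: "(\<lambda>y. S i j y $ k $ l) differentiable at x" for i j k l
    by (rule smooth_mat_differentiable[OF open_U smooth_S x])
  have 1: "mpd m (S j i) x = - mpd m (S i j) x" for m i j
    unfolding S_swap[of j i, abs_def] by (rule mpd_uminus[OF open_U smooth_S x])
  have 2: "mpd m (S i j) x $ k $ l = - mpd m (S i j) x $ l $ k" for m i j k l
  proof -
    have "mpd m (S i j) x $ k $ l = pd m (\<lambda>y. - S i j y $ l $ k) x"
      by (simp add: mpd_def) (rule pd_cong_open[OF open_U x S_swap_upper])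
    then show ?thesis by (simp add: mpd_def pd_minus dS)
  qed
  have 3: "pd m (scalar_coord G) x = (\<Sum>i\<in>UNIV. \<Sum>j\<in>UNIV. mpd m (S i j) x $ i $ j)"
    unfolding scalar_coord_eq_S[abs_def] by (simp add: pd_sum dS mpd_def differentiable_sum)
  have 4: "pd i (\<lambda>y. P y $ i $ m) x = (\<Sum>j\<in>UNIV. mpd i (S j m) x $ j $ i)" for i
    by (simp add: P_def pd_sum dS mpd_def)
  have 5: "P x $ a $ i = (\<Sum>j\<in>UNIV. S j i x $ j $ a)" for a i
    by (simp add: P_def)
  show ?thesis unfolding 3 4 5
  proof (rule contracted_bianchi_algebra[where s = "\<lambda>i j. S i j x"
        and d = "\<lambda>m i j. mpd m (S i j) x" and \<gamma> = "\<lambda>i. Gam i x"])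
    show "S j i x = - S i j x" for i j by (rule S_swap)
    show "S i j x $ k $ l = - S i j x $ l $ k" for i j l k by (rule S_swap_upper[OF x])
    show "Gam i x $ l $ k = Gam k x $ l $ i" for i l k by (rule Gam_swap[OF x])
  qed (fact 1 2 second_bianchi_S[OF x])+
qed

end

subsection \<open>Gradient fields with conformal Hessian\<close>

definition ginner :: "(real ^ 'n::finite \<Rightarrow> real ^ 'n ^ 'n) \<Rightarrow> (real ^ 'n \<Rightarrow> real) \<Rightarrow> (real ^ 'n \<Rightarrow> real)
    \<Rightarrow> real ^ 'n \<Rightarrow> real"
  where "ginner G u v x = (\<Sum>i\<in>UNIV. \<Sum>j\<in>UNIV. matrix_inv (G x) $ i $ j * pd i u x * pd j v x)"

lemma ginner_cong_open:
  assumes "open S" "x \<in> S" "\<And>y. y \<in> S \<Longrightarrow> u y = u' y" "\<And>y. y \<in> S \<Longrightarrow> v y = v' y"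
  shows "ginner G u v x = ginner G u' v' x"
  using pd_cong_open[OF assms(1,2), of u u'] pd_cong_open[OF assms(1,2), of v v'] assms(3,4)
  by (simp add: ginner_def)

context riemannian_coords
begin

definition vdiv :: "('n \<Rightarrow> real ^ 'n \<Rightarrow> real) \<Rightarrow> real ^ 'n \<Rightarrow> real"
  where "vdiv V x = (\<Sum>i\<in>UNIV. pd i (V i) x) + (\<Sum>i\<in>UNIV. \<Sum>a\<in>UNIV. Gam i x $ i $ a * V a x)"

lemma vdiv_cmult: "(\<And>i. V i differentiable at x) \<Longrightarrow> vdiv (\<lambda>i y. c * V i y) x = c * vdiv V x"
  by (simp add: vdiv_def pd_cmult sum_distrib_left distrib_left mult_ac)

lemma vdiv_mult:
  assumes "k differentiable at x" "\<And>i. V i differentiable at x"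
  shows "vdiv (\<lambda>i y. k y * V i y) x = (\<Sum>i\<in>UNIV. V i x * pd i k x) + k x * vdiv V x"
  using assms by (simp add: vdiv_def pd_mult sum.distrib sum_distrib_left distrib_left mult_ac)

lemma vdiv_cong_open:
  assumes "open T" "x \<in> T" "\<And>i y. y \<in> T \<Longrightarrow> V i y = W i y"
  shows "vdiv V x = vdiv W x"
  using assms(3)[OF assms(2)] pd_cong_open[OF assms(1,2), of "V i" "W i" i for i] assms(3)
  by (simp add: vdiv_def)

lemma H_swap: "x \<in> U \<Longrightarrow> H x $ i $ j = H x $ j $ i"
  using arg_cong[OF sym_H, of x "\<lambda>A. A $ j $ i"] by (simp add: transpose_def)

lemma G_swap: "x \<in> U \<Longrightarrow> G x $ i $ j = G x $ j $ i"
  using arg_cong[OF sym_G, of x "\<lambda>A. A $ j $ i"] by (simp add: transpose_def)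

lemma smooth_ginner:
  assumes "smooth_on T u" "smooth_on T v" "open T" "T \<subseteq> U"
  shows "smooth_on T (ginner G u v)"
  unfolding ginner_def[abs_def] H_def[symmetric]
  by (intro smooth_on_sum smooth_on_mult smooth_on_pd assms
      smooth_on_mono[OF smooth_mat_nth[OF open_U smooth_H] \<open>T \<subseteq> U\<close>])

end

text \<open>Here \<phi> is any smooth factor of proportionality between Hessian and metric; its link
  to the scalar curvature enters only in \<open>yamabe_coords\<close>.\<close>

locale conformal_hessian = riemannian_coords U G
  for U :: "(real ^ 'n::finite) set" and G +
  fixes u \<phi> :: "real ^ 'n \<Rightarrow> real"
  assumes smooth_u: "smooth_on U u" and smooth_\<phi>: "smooth_on U \<phi>"
    and hessian_eq: "x \<in> U \<Longrightarrow> \<phi> x * G x $ i $ j = hessian_coord G u i j x"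
begin

definition X :: "'n \<Rightarrow> real ^ 'n \<Rightarrow> real"
  where "X i x = (\<Sum>k\<in>UNIV. H x $ i $ k * pd k u x)"

lemma smooth_X: "smooth_on U (X i)"
  unfolding X_def[abs_def]
  by (intro smooth_on_sum smooth_on_mult smooth_on_pd smooth_mat_nth[OF open_U smooth_H]
      smooth_u open_U)

lemma diff_X: "x \<in> U \<Longrightarrow> X i differentiable at x"
  using smooth_X smooth_on_differentiable by blast

lemma diff_\<phi>: "x \<in> U \<Longrightarrow> \<phi> differentiable at x"
  using smooth_\<phi> smooth_on_differentiable by blast

lemma diff_pd_u: "x \<in> U \<Longrightarrow> pd i u differentiable at x"
  using smooth_u smooth_on_differentiable smooth_on_pd by blast

lemma diff_G: "x \<in> U \<Longrightarrow> (\<lambda>y. G y $ i $ j) differentiable at x"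
  by (rule smooth_mat_differentiable[OF open_U smooth_G])

lemma diff_H: "x \<in> U \<Longrightarrow> (\<lambda>y. H y $ i $ j) differentiable at x"
  by (rule smooth_mat_differentiable[OF open_U smooth_H])

lemma diff_Gam: "x \<in> U \<Longrightarrow> (\<lambda>y. Gam m y $ i $ j) differentiable at x"
  by (rule smooth_mat_differentiable[OF open_U smooth_Gam])

lemma pd_pd_u:
  "x \<in> U \<Longrightarrow> pd i (pd j u) x = (\<Sum>l\<in>UNIV. Gam i x $ l $ j * pd l u x) + \<phi> x * G x $ i $ j"
  using hessian_eq[of x i j] by (simp add: hessian_coord_def cov_deriv_def Gam_def)

lemma G_X:
  assumes x: "x \<in> U"
  shows "(\<Sum>k\<in>UNIV. G x $ i $ k * X k x) = pd i u x"
proof -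
  have "G x *v (H x *v (\<chi> k. pd k u x)) = (\<chi> k. pd k u x)"
    by (simp add: matrix_vector_mul_assoc G_H x)
  then have "(G x *v (H x *v (\<chi> k. pd k u x))) $ i = pd i u x" by simp
  then show ?thesis by (simp add: matrix_vector_mult_def X_def)
qed

text \<open>The gradient field X satisfies \<open>nabla_i X^l = \<phi> delta_i^l\<close>: raising an
  index commutes with covariant differentiation because H is parallel.\<close>

lemma pd_X:
  assumes x: "x \<in> U"
  shows "pd i (X l) x = (if i = l then \<phi> x else 0) - (\<Sum>a\<in>UNIV. Gam i x $ l $ a * X a x)"
proof -
  let ?w = "(\<chi> k. pd k u x) :: real ^ 'n"
  have Hw: "(\<chi> a. X a x) = H x *v ?w"
    by (simp add: vec_eq_iff matrix_vector_mult_def X_def)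
  have dw: "(\<chi> k. pd i (pd k u) x) = transpose (Gam i x) *v ?w + \<phi> x *\<^sub>R (G x *v axis i 1)"
    using G_swap[OF x]
    by (simp add: vec_eq_iff matrix_vector_mult_def vector_matrix_mult_def transpose_def pd_pd_u x axis_def if_distrib
        sum.delta mult.commute cong: if_cong)
  have neg: "(- A) *v w = - (A *v w)" for A :: "real ^ 'n ^ 'n" and w
    using matrix_vector_mult_diff_rdistrib[of 0 A w] by simp
  have "pd i (X l) x = (mpd i H x *v ?w + H x *v (\<chi> k. pd i (pd k u) x)) $ l"
    by (simp add: X_def[abs_def] pd_sum pd_mult diff_H diff_pd_u x differentiable_mult sum.distrib
        matrix_vector_mult_def mpd_def)
  also have "mpd i H x *v ?w + H x *v (\<chi> k. pd i (pd k u) x) =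
     - (Gam i x *v (H x *v ?w)) + \<phi> x *\<^sub>R (H x *v (G x *v axis i 1))"
    unfolding dw mpd_H[OF x]
    by (simp only: neg matrix_vector_mult_diff_rdistrib matrix_vector_right_distrib
        matrix_vector_mul_assoc matrix_vector_mult_scaleR) simp
  also have "H x *v (G x *v axis i 1) = axis i 1"
    by (simp add: matrix_vector_mul_assoc H_G x)
  also have "(- (Gam i x *v (H x *v ?w)) + \<phi> x *\<^sub>R axis i 1) $ l =
     (if i = l then \<phi> x else 0) - (\<Sum>a\<in>UNIV. Gam i x $ l $ a * X a x)"
    unfolding Hw[symmetric] by (simp add: matrix_vector_mult_def axis_def)
  finally show ?thesis .
qed

text \<open>The Ricci identity for du: third derivatives of u commute, and inserting the Hessian
  equation turns their difference into derivatives of \<phi> on one side and curvature on the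
  other.\<close>

lemma Rm_du:
  assumes x: "x \<in> U"
  shows "(\<Sum>l\<in>UNIV. Rm i j x $ l $ k * pd l u x) = pd j \<phi> x * G x $ i $ k - pd i \<phi> x * G x $ j $ k"
proof -
  have 2: "pd i (pd j (pd k u)) x = (\<Sum>l\<in>UNIV. (mpd i (Gam j) x + Gam i x ** Gam j x) $ l $ k * pd l u x)
      + \<phi> x * ((G x ** Gam j x) $ i $ k + (G x ** Gam i x) $ k $ j + (G x ** Gam i x) $ j $ k)
      + pd i \<phi> x * G x $ j $ k" for i j
  proof -
    have "pd i (pd j (pd k u)) x =
        pd i (\<lambda>y. (\<Sum>l\<in>UNIV. Gam j y $ l $ k * pd l u y) + \<phi> y * G y $ j $ k) x"
      by (rule pd_cong_open[OF open_U x pd_pd_u])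
    also have "\<dots> = (\<Sum>l\<in>UNIV. pd i (\<lambda>y. Gam j y $ l $ k) x * pd l u x + Gam j x $ l $ k * pd i (pd l u) x)
        + (pd i \<phi> x * G x $ j $ k + \<phi> x * pd i (\<lambda>y. G y $ j $ k) x)"
      by (simp add: pd_add pd_sum pd_mult diff_Gam diff_pd_u diff_\<phi> diff_G x differentiable_mult
          differentiable_sum)
    also have "pd i (\<lambda>y. G y $ j $ k) x = (G x ** Gam i x) $ k $ j + (G x ** Gam i x) $ j $ k"
    proof -
      have "pd i (\<lambda>y. G y $ j $ k) x = mpd i G x $ j $ k" by (simp add: mpd_def)
      also have "transpose (Gam i x) ** G x = transpose (G x ** Gam i x)"
        by (simp add: matrix_transpose_mul sym_G x)
      then have "mpd i G x = transpose (G x ** Gam i x) + G x ** Gam i x"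
        using mpd_G[OF x, of i] by simp
      finally show ?thesis by (simp add: transpose_def)
    qed
    also have "(\<Sum>l\<in>UNIV. pd i (\<lambda>y. Gam j y $ l $ k) x * pd l u x + Gam j x $ l $ k * pd i (pd l u) x) =
        (\<Sum>l\<in>UNIV. mpd i (Gam j) x $ l $ k * pd l u x) +
        (\<Sum>l\<in>UNIV. (Gam i x ** Gam j x) $ l $ k * pd l u x) + \<phi> x * (G x ** Gam j x) $ i $ k"
    proof -
      have "(\<Sum>l\<in>UNIV. Gam j x $ l $ k * (\<Sum>m\<in>UNIV. Gam i x $ m $ l * pd m u x)) =
          (\<Sum>l\<in>UNIV. \<Sum>m\<in>UNIV. Gam i x $ m $ l * Gam j x $ l $ k * pd m u x)"
        by (simp add: sum_distrib_left mult_ac)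
      also have "\<dots> = (\<Sum>m\<in>UNIV. \<Sum>l\<in>UNIV. Gam i x $ m $ l * Gam j x $ l $ k * pd m u x)"
        by (rule sum.swap)
      also have "\<dots> = (\<Sum>m\<in>UNIV. (Gam i x ** Gam j x) $ m $ k * pd m u x)"
        by (simp add: matrix_matrix_mult_def sum_distrib_right)
      finally have "(\<Sum>l\<in>UNIV. Gam j x $ l $ k * (\<Sum>m\<in>UNIV. Gam i x $ m $ l * pd m u x)) =
          (\<Sum>m\<in>UNIV. (Gam i x ** Gam j x) $ m $ k * pd m u x)" .
      moreover have "(\<Sum>l\<in>UNIV. Gam j x $ l $ k * (\<phi> x * G x $ i $ l)) = \<phi> x * (G x ** Gam j x) $ i $ k"
        by (simp add: matrix_matrix_mult_def sum_distrib_left mult_ac)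
      ultimately show ?thesis
        by (simp add: pd_pd_u x mpd_def sum.distrib distrib_left)
    qed
    finally show ?thesis
      by (simp add: sum.distrib distrib_left distrib_right)
  qed
  \<comment> \<open>With this the undifferentiated \<phi> terms become symmetric in i and j, so they
    drop out of the difference.\<close>
  have GG: "(G x ** Gam i x) $ k $ j = (G x ** Gam j x) $ k $ i"
    unfolding matrix_matrix_mult_def by (simp add: Gam_swap[OF x, of i _ j])
  have "pd i (pd j (pd k u)) x = pd j (pd i (pd k u)) x"
    by (rule pd_commute[OF open_U x smooth_on_pd[OF smooth_u]])
  then have "(\<Sum>l\<in>UNIV. (mpd i (Gam j) x + Gam i x ** Gam j x) $ l $ k * pd l u x) -
      (\<Sum>l\<in>UNIV. (mpd j (Gam i) x + Gam j x ** Gam i x) $ l $ k * pd l u x) =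
      pd j \<phi> x * G x $ i $ k - pd i \<phi> x * G x $ j $ k"
    unfolding 2 GG by (simp add: algebra_simps)
  then show ?thesis
    unfolding sum_subtractf[symmetric] Rm_def by (simp add: algebra_simps)
qed

lemma S_du:
  assumes x: "x \<in> U"
  shows "(\<Sum>k\<in>UNIV. S i j x $ l $ k * pd k u x) =
    (if j = l then pd i \<phi> x else 0) - (if i = l then pd j \<phi> x else 0)"
proof -
  have GH: "(\<Sum>k\<in>UNIV. G x $ i $ k * H x $ k $ l) = (if i = l then 1 else 0)" for i
    using arg_cong[OF G_H[OF x], of "\<lambda>A. A $ i $ l"] by (simp add: matrix_matrix_mult_def mat_def)
  have "(\<Sum>k\<in>UNIV. S i j x $ l $ k * pd k u x) = - (\<Sum>k\<in>UNIV. S i j x $ k $ l * pd k u x)"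
    unfolding sum_negf[symmetric]
    by (rule sum.cong[OF refl]) (simp add: S_swap_upper[OF x, of i j l])
  also have "(\<Sum>k\<in>UNIV. S i j x $ k $ l * pd k u x) =
      (\<Sum>k\<in>UNIV. \<Sum>a\<in>UNIV. Rm i j x $ k $ a * pd k u x * H x $ a $ l)"
    by (simp add: S_def matrix_matrix_mult_def sum_distrib_left sum_distrib_right mult_ac)
  also have "\<dots> = (\<Sum>a\<in>UNIV. (\<Sum>k\<in>UNIV. Rm i j x $ k $ a * pd k u x) * H x $ a $ l)"
    by (subst sum.swap) (simp add: sum_distrib_right)
  also have "\<dots> = pd j \<phi> x * (\<Sum>a\<in>UNIV. G x $ i $ a * H x $ a $ l) -
      pd i \<phi> x * (\<Sum>a\<in>UNIV. G x $ j $ a * H x $ a $ l)"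
    unfolding Rm_du[OF x]
    by (simp add: left_diff_distrib right_diff_distrib sum_subtractf sum_distrib_left mult_ac)
  finally show ?thesis unfolding GH by simp
qed

text \<open>Contracting \<open>S_du\<close> once more with du gives zero on the curvature side, by
  antisymmetry in the upper indices.\<close>

lemma parallel:
  assumes x: "x \<in> U"
  shows "pd i \<phi> x * pd j u x = pd j \<phi> x * pd i u x"
proof -
  let ?z = "\<Sum>l\<in>UNIV. pd l u x * (\<Sum>k\<in>UNIV. S i j x $ l $ k * pd k u x)"
  have "?z = (\<Sum>l\<in>UNIV. \<Sum>k\<in>UNIV. pd l u x * S i j x $ l $ k * pd k u x)"
    by (simp add: sum_distrib_left mult_ac)
  also have "\<dots> = (\<Sum>k\<in>UNIV. \<Sum>l\<in>UNIV. pd l u x * S i j x $ l $ k * pd k u x)"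
    by (rule sum.swap)
  also have "\<dots> = (\<Sum>k\<in>UNIV. \<Sum>l\<in>UNIV. - (pd k u x * S i j x $ k $ l * pd l u x))"
  proof (intro sum.cong refl)
    fix k l
    show "pd l u x * S i j x $ l $ k * pd k u x = - (pd k u x * S i j x $ k $ l * pd l u x)"
      by (simp add: S_swap_upper[OF x, of i j l k] mult_ac)
  qed
  also have "\<dots> = - ?z"
    by (simp add: sum_negf sum_distrib_left mult_ac)
  finally have "?z = 0" by simp
  moreover have "?z = (\<Sum>l\<in>UNIV. if j = l then pd l u x * pd i \<phi> x else 0) -
      (\<Sum>l\<in>UNIV. if i = l then pd l u x * pd j \<phi> x else 0)"
    unfolding S_du[OF x] sum_subtractf[symmetric]
    by (intro sum.cong refl) (simp add: right_diff_distrib)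
  ultimately show ?thesis by (simp add: mult.commute)
qed

text \<open>The trace of \<open>S_du\<close>: the n equal terms, less the one from the diagonal,
  give Ric(grad u) = -(n-1) d\<phi>.\<close>

lemma P_du:
  assumes x: "x \<in> U"
  shows "(\<Sum>j\<in>UNIV. P x $ j $ m * pd j u x) = (1 - real CARD('n)) * pd m \<phi> x"
proof -
  have "(\<Sum>j\<in>UNIV. P x $ j $ m * pd j u x) = (\<Sum>j\<in>UNIV. \<Sum>i\<in>UNIV. S i m x $ i $ j * pd j u x)"
    by (simp add: P_def sum_distrib_right)
  also have "\<dots> = (\<Sum>i\<in>UNIV. \<Sum>j\<in>UNIV. S i m x $ i $ j * pd j u x)"
    by (rule sum.swap)
  also have "\<dots> = (\<Sum>i\<in>UNIV. (if m = i then pd i \<phi> x else 0) - pd m \<phi> x)"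
    by (simp add: S_du[OF x])
  also have "\<dots> = (1 - real CARD('n)) * pd m \<phi> x"
    by (simp add: sum_subtractf algebra_simps)
  finally show ?thesis .
qed

definition Y :: "'n \<Rightarrow> real ^ 'n \<Rightarrow> real"
  where "Y i x = (\<Sum>k\<in>UNIV. H x $ i $ k * pd k \<phi> x)"

lemma smooth_Y: "smooth_on U (Y i)"
  unfolding Y_def[abs_def]
  by (intro smooth_on_sum smooth_on_mult smooth_on_pd smooth_mat_nth[OF open_U smooth_H]
      smooth_\<phi> open_U)

lemma diff_Y: "x \<in> U \<Longrightarrow> Y i differentiable at x"
  using smooth_Y smooth_on_differentiable by blast

text \<open>The same identity as \<open>P_du\<close> with the other index of P contracted, as needed
  to take a divergence; symmetry of Ricci allows the exchange.\<close>

lemma P_X: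
  assumes x: "x \<in> U"
  shows "(\<Sum>m\<in>UNIV. P x $ j $ m * X m x) = (1 - real CARD('n)) * Y j x"
proof -
  let ?w = "(\<chi> k. pd k u x) :: real ^ 'n"
  have "transpose (P x) *v ?w = (1 - real CARD('n)) *\<^sub>R (\<chi> m. pd m \<phi> x)"
    using P_du[OF x] by (simp add: vec_eq_iff vector_matrix_mult_def mult.commute)
  moreover have "H x ** transpose (P x) = P x ** H x"
    by (simp add: P_eq[OF x] matrix_transpose_mul sym_H x transpose_Ric matrix_mul_assoc)
  then have "P x *v (H x *v ?w) = H x *v (transpose (P x) *v ?w)"
    by (metis matrix_vector_mul_assoc)
  ultimately have "P x *v (H x *v ?w) = (1 - real CARD('n)) *\<^sub>R (H x *v (\<chi> m. pd m \<phi> x))"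
    by (simp only: matrix_vector_mult_scaleR)
  then have "(P x *v (H x *v ?w)) $ j = (1 - real CARD('n)) * (H x *v (\<chi> m. pd m \<phi> x)) $ j"
    by simp
  then show ?thesis
    by (simp add: matrix_vector_mult_def X_def Y_def)
qed

lemma vdiv_X:
  assumes "x \<in> U"
  shows "vdiv X x = real CARD('n) * \<phi> x"
  unfolding vdiv_def by (simp add: pd_X[OF assms] sum_subtractf)

text \<open>The divergence of $\mathrm{Ric}(\nabla u) = -(n-1)\nabla\varphi$.\<close>

lemma vdiv_Y:
  assumes x: "x \<in> U"
  shows "(1 - real CARD('n)) * vdiv Y x =
    (\<Sum>m\<in>UNIV. X m x * pd m (scalar_coord G) x) / 2 + scalar_coord G x * \<phi> x"
proof -
  let ?W = "\<lambda>i y. \<Sum>m\<in>UNIV. P y $ i $ m * X m y"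
  have dP: "(\<lambda>y. P y $ i $ m) differentiable at x" for i m
    by (rule smooth_mat_differentiable[OF open_U smooth_P x])
  have "(1 - real CARD('n)) * vdiv Y x = vdiv (\<lambda>i y. (1 - real CARD('n)) * Y i y) x"
    by (simp add: vdiv_cmult diff_Y x)
  also have "\<dots> = vdiv ?W x"
    by (rule vdiv_cong_open[OF open_U x]) (simp add: P_X)
  also have "\<dots> = (\<Sum>i\<in>UNIV. \<Sum>m\<in>UNIV. pd i (\<lambda>y. P y $ i $ m) x * X m x) +
      (\<Sum>i\<in>UNIV. \<Sum>m\<in>UNIV. P x $ i $ m * pd i (X m) x) +
      (\<Sum>i\<in>UNIV. \<Sum>a\<in>UNIV. Gam i x $ i $ a * ?W a x)"
    by (simp add: vdiv_def pd_sum pd_mult dP diff_X x differentiable_mult sum.distrib)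
  also have "(\<Sum>i\<in>UNIV. \<Sum>m\<in>UNIV. pd i (\<lambda>y. P y $ i $ m) x * X m x) =
      (\<Sum>m\<in>UNIV. X m x * (\<Sum>i\<in>UNIV. pd i (\<lambda>y. P y $ i $ m) x))"
    by (subst sum.swap) (simp add: sum_distrib_left mult.commute)
  also have "(\<Sum>i\<in>UNIV. \<Sum>a\<in>UNIV. Gam i x $ i $ a * ?W a x) =
      (\<Sum>m\<in>UNIV. X m x * (\<Sum>i\<in>UNIV. \<Sum>a\<in>UNIV. Gam i x $ i $ a * P x $ a $ m))" (is "?l = ?r")
  proof -
    have "?l = (\<Sum>i\<in>UNIV. \<Sum>m\<in>UNIV. \<Sum>a\<in>UNIV. X m x * (Gam i x $ i $ a * P x $ a $ m))"
    proof (rule sum.cong[OF refl])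
      fix i
      have "(\<Sum>a\<in>UNIV. Gam i x $ i $ a * ?W a x) =
          (\<Sum>a\<in>UNIV. \<Sum>m\<in>UNIV. X m x * (Gam i x $ i $ a * P x $ a $ m))"
        by (simp add: sum_distrib_left mult_ac)
      also have "\<dots> = (\<Sum>m\<in>UNIV. \<Sum>a\<in>UNIV. X m x * (Gam i x $ i $ a * P x $ a $ m))"
        by (rule sum.swap)
      finally show "(\<Sum>a\<in>UNIV. Gam i x $ i $ a * ?W a x) =
          (\<Sum>m\<in>UNIV. \<Sum>a\<in>UNIV. X m x * (Gam i x $ i $ a * P x $ a $ m))" .
    qed
    also have "\<dots> = (\<Sum>m\<in>UNIV. \<Sum>i\<in>UNIV. \<Sum>a\<in>UNIV. X m x * (Gam i x $ i $ a * P x $ a $ m))"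
      by (rule sum.swap)
    finally show ?thesis by (simp add: sum_distrib_left)
  qed
  \<comment> \<open>The identity part of the covariant derivative of X meets the trace of P, which
    is the scalar curvature. The Christoffel part is the term that completes the divergence in
    \<open>contracted_bianchi\<close>.\<close>
  also have "(\<Sum>i\<in>UNIV. \<Sum>m\<in>UNIV. P x $ i $ m * pd i (X m) x) = \<phi> x * scalar_coord G x -
      (\<Sum>m\<in>UNIV. X m x * (\<Sum>i\<in>UNIV. \<Sum>a\<in>UNIV. Gam m x $ i $ a * P x $ a $ i))" (is "?l = _ - ?r")
  proof -
    have "?l = (\<Sum>i\<in>UNIV. \<Sum>m\<in>UNIV. P x $ i $ m * (if i = m then \<phi> x else 0)) -
        (\<Sum>i\<in>UNIV. \<Sum>m\<in>UNIV. \<Sum>a\<in>UNIV. P x $ i $ m * Gam i x $ m $ a * X a x)"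
      by (simp add: pd_X[OF x] right_diff_distrib sum_subtractf sum_distrib_left mult_ac)
    also have "(\<Sum>i\<in>UNIV. \<Sum>m\<in>UNIV. P x $ i $ m * (if i = m then \<phi> x else 0)) = \<phi> x * scalar_coord G x"
      by (simp add: scalar_coord_eq_trace_P if_distrib sum_distrib_left mult.commute cong: if_cong)
    also have "(\<Sum>i\<in>UNIV. \<Sum>m\<in>UNIV. \<Sum>a\<in>UNIV. P x $ i $ m * Gam i x $ m $ a * X a x) = ?r"
    proof -
      have "(\<Sum>i\<in>UNIV. \<Sum>m\<in>UNIV. \<Sum>a\<in>UNIV. P x $ i $ m * Gam i x $ m $ a * X a x) =
          (\<Sum>i\<in>UNIV. \<Sum>a\<in>UNIV. \<Sum>m\<in>UNIV. P x $ i $ m * Gam i x $ m $ a * X a x)"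
        by (intro sum.cong refl sum.swap)
      also have "\<dots> = (\<Sum>a\<in>UNIV. \<Sum>i\<in>UNIV. \<Sum>m\<in>UNIV. P x $ i $ m * Gam i x $ m $ a * X a x)"
        by (rule sum.swap)
      also have "\<dots> = (\<Sum>a\<in>UNIV. \<Sum>m\<in>UNIV. \<Sum>i\<in>UNIV. P x $ i $ m * Gam i x $ m $ a * X a x)"
        by (intro sum.cong refl sum.swap)
      also have "\<dots> = ?r"
        unfolding sum_distrib_left
        by (intro sum.cong refl) (simp add: Gam_swap[OF x] mult_ac)
      finally show ?thesis .
    qed
    finally show ?thesis .
  qed
  finally show ?thesis
    unfolding contracted_bianchi[OF x]
    by (simp add: right_diff_distrib distrib_left sum.distrib sum_subtractf sum_distrib_left[symmetric]
        mult.left_commute[of _ 2])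
qed

section \<open>Derivatives along the gradient of u\<close>

definition h2 :: "real ^ 'n \<Rightarrow> real"
  where "h2 = ginner G u u"

definition XD :: "(real ^ 'n \<Rightarrow> real) \<Rightarrow> real ^ 'n \<Rightarrow> real"
  where "XD f x = (\<Sum>i\<in>UNIV. X i x * pd i f x)"

lemma ginner_u_right:
  assumes "x \<in> U" shows "ginner G f u x = XD f x"
  unfolding ginner_def XD_def X_def H_def[symmetric]
  by (simp add: sum_distrib_left sum_distrib_right mult_ac)

lemma h2_eq: "x \<in> U \<Longrightarrow> h2 x = XD u x"
  unfolding h2_def by (rule ginner_u_right)

lemma smooth_h2: "smooth_on U h2"
  unfolding h2_def by (intro smooth_ginner smooth_u open_U) simp

text \<open>Positivity is assumed for G and not for its inverse, so |du|^2 is rewritten as G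
  evaluated on the gradient X.\<close>

lemma h2_pos:
  assumes x: "x \<in> U" and "pd i u x \<noteq> 0"
  shows "h2 x > 0"
proof -
  let ?v = "\<chi> k. X k x"
  have "?v \<noteq> 0"
  proof
    assume "?v = 0"
    then have "X k x = 0" for k by (simp add: vec_eq_iff)
    then show False using G_X[OF x, of i] assms(2) by simp
  qed
  then have "?v \<bullet> (G x *v ?v) > 0" by (rule pos_G[OF x])
  moreover have "G x *v ?v = (\<chi> i. pd i u x)"
    by (simp add: vec_eq_iff matrix_vector_mult_def G_X[OF x])
  ultimately show ?thesis
    by (simp add: h2_eq[OF x] XD_def inner_vec_def)
qed

lemma h2_nonneg:
  assumes x: "x \<in> U"
  shows "h2 x \<ge> 0"
proof (cases "\<forall>i. pd i u x = 0")
  case True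
  then show ?thesis by (simp add: h2_eq[OF x] XD_def)
next
  case False
  then show ?thesis using h2_pos[OF x] by fastforce
qed

text \<open>Both factors of |du|^2 contribute \<phi> du, and their Christoffel terms cancel. Hence
  |du|^2 changes only in the direction of du, so it is locally constant on regular level
  sets.\<close>

lemma pd_h2:
  assumes x: "x \<in> U"
  shows "pd i h2 x = 2 * \<phi> x * pd i u x"
proof -
  have "pd i h2 x = pd i (\<lambda>y. \<Sum>k\<in>UNIV. X k y * pd k u y) x"
    by (rule pd_cong_open[OF open_U x]) (simp add: h2_eq XD_def)
  also have "\<dots> = (\<Sum>k\<in>UNIV. pd i (X k) x * pd k u x) + (\<Sum>k\<in>UNIV. X k x * pd i (pd k u) x)"
    by (simp add: pd_sum pd_mult diff_X diff_pd_u x differentiable_mult sum.distrib)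
  also have "(\<Sum>k\<in>UNIV. pd i (X k) x * pd k u x) =
      \<phi> x * pd i u x - (\<Sum>k\<in>UNIV. \<Sum>a\<in>UNIV. Gam i x $ k $ a * pd k u x * X a x)"
  proof -
    have "(\<Sum>k\<in>UNIV. pd i (X k) x * pd k u x) = (\<Sum>k\<in>UNIV. if i = k then \<phi> x * pd k u x else 0) -
        (\<Sum>k\<in>UNIV. \<Sum>a\<in>UNIV. Gam i x $ k $ a * pd k u x * X a x)"
      unfolding pd_X[OF x] sum_subtractf[symmetric]
      by (intro sum.cong refl)
        (simp add: left_diff_distrib right_diff_distrib sum_distrib_left mult_ac)
    then show ?thesis by simp
  qed
  also have "(\<Sum>k\<in>UNIV. X k x * pd i (pd k u) x) =
      (\<Sum>k\<in>UNIV. \<Sum>l\<in>UNIV. Gam i x $ l $ k * pd l u x * X k x) + \<phi> x * (\<Sum>k\<in>UNIV. G x $ i $ k * X k x)"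
    by (simp add: pd_pd_u[OF x] distrib_left sum.distrib sum_distrib_left mult_ac)
  also have "(\<Sum>k\<in>UNIV. \<Sum>l\<in>UNIV. Gam i x $ l $ k * pd l u x * X k x) =
      (\<Sum>k\<in>UNIV. \<Sum>a\<in>UNIV. Gam i x $ k $ a * pd k u x * X a x)"
    by (rule sum.swap)
  finally show ?thesis by (simp add: G_X[OF x])
qed

lemma XD_h2: "x \<in> U \<Longrightarrow> XD h2 x = 2 * \<phi> x * h2 x"
  by (simp add: XD_def pd_h2 h2_eq sum_distrib_left mult_ac)

lemma pd_\<phi>_h2:
  assumes x: "x \<in> U"
  shows "pd i \<phi> x * h2 x = XD \<phi> x * pd i u x"
proof -
  have "pd i \<phi> x * h2 x = (\<Sum>j\<in>UNIV. X j x * (pd i \<phi> x * pd j u x))"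
    by (simp add: h2_eq[OF x] XD_def sum_distrib_left mult_ac)
  also have "\<dots> = (\<Sum>j\<in>UNIV. X j x * (pd j \<phi> x * pd i u x))"
    by (simp only: parallel[OF x, of i])
  finally show ?thesis by (simp add: XD_def sum_distrib_left mult_ac)
qed

lemma XD_add: "f differentiable at x \<Longrightarrow> g differentiable at x \<Longrightarrow>
    XD (\<lambda>y. f y + g y) x = XD f x + XD g x"
  by (simp add: XD_def pd_add distrib_left sum.distrib)

lemma XD_diff: "f differentiable at x \<Longrightarrow> g differentiable at x \<Longrightarrow>
    XD (\<lambda>y. f y - g y) x = XD f x - XD g x"
  by (simp add: XD_def pd_diff right_diff_distrib sum_subtractf)

lemma XD_cmult: "f differentiable at x \<Longrightarrow> XD (\<lambda>y. c * f y) x = c * XD f x"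
  by (simp add: XD_def pd_cmult sum_distrib_left mult_ac)

lemma XD_mult: "f differentiable at x \<Longrightarrow> g differentiable at x \<Longrightarrow>
    XD (\<lambda>y. f y * g y) x = XD f x * g x + f x * XD g x"
  by (simp add: XD_def pd_mult distrib_left sum.distrib sum_distrib_left sum_distrib_right mult_ac)

lemma XD_const: "XD (\<lambda>y. c) x = 0"
  by (simp add: XD_def)

lemma smooth_XD_\<phi>: "smooth_on U (XD \<phi>)"
  unfolding XD_def[abs_def]
  by (intro smooth_on_sum smooth_on_mult smooth_on_pd smooth_X smooth_\<phi> open_U)

text \<open>Near a regular point grad \<phi> = \<kappa> grad u with \<kappa> the ratio of
  \<open>XD \<phi>\<close> to \<open>h2\<close>. Then div Y = X\<kappa> + n\<phi>\<kappa>, while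
  X(X\<phi>) is the derivative of \<kappa> |du|^2; eliminating X\<kappa> gives the formula.\<close>

lemma XD_XD_\<phi>:
  assumes x: "x \<in> U" and nz: "h2 x \<noteq> 0"
  shows "XD (XD \<phi>) x = h2 x * vdiv Y x - real CARD('n) * \<phi> x * XD \<phi> x + 2 * \<phi> x * XD \<phi> x"
proof -
  define T where "T = {y\<in>U. h2 y \<noteq> 0}"
  have "T = U \<inter> h2 -` (- {0})" by (auto simp: T_def)
  then have T: "open T" "x \<in> T"
    using continuous_open_preimage[OF smooth_on_continuous_on[OF smooth_h2] open_U, of "- {0}"]
      x nz by (auto simp: T_def)
  define \<kappa> where "\<kappa> y = XD \<phi> y / h2 y" for y
  have "smooth_on T \<kappa>"
    unfolding \<kappa>_def[abs_def]
    by (intro smooth_on_divide smooth_on_mono[OF smooth_XD_\<phi>] smooth_on_mono[OF smooth_h2] T)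
      (auto simp: T_def)
  then have d\<kappa>: "\<kappa> differentiable at x"
    using smooth_on_differentiable T by blast
  have dh2: "h2 differentiable at x"
    using smooth_h2 smooth_on_differentiable x by blast
  have "vdiv Y x = vdiv (\<lambda>i y. \<kappa> y * X i y) x"
  proof (rule vdiv_cong_open[OF T])
    fix i y assume y: "y \<in> T"
    then have "pd k \<phi> y = \<kappa> y * pd k u y" for k
      using pd_\<phi>_h2[of y k] by (simp add: \<kappa>_def T_def field_simps)
    then show "Y i y = \<kappa> y * X i y"
      by (simp add: Y_def X_def sum_distrib_left mult_ac)
  qed
  also have "\<dots> = XD \<kappa> x + \<kappa> x * (real CARD('n) * \<phi> x)"
    by (simp add: vdiv_mult d\<kappa> diff_X x XD_def vdiv_X)
  finally have 1: "vdiv Y x = XD \<kappa> x + \<kappa> x * (real CARD('n) * \<phi> x)" .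
  have "XD (XD \<phi>) x = XD (\<lambda>y. \<kappa> y * h2 y) x"
    unfolding XD_def by (intro sum.cong refl arg_cong2[of _ _ _ _ "(*)"] pd_cong_open[OF T])
      (simp add: \<kappa>_def T_def XD_def)
  also have "\<dots> = XD \<kappa> x * h2 x + \<kappa> x * (2 * \<phi> x * h2 x)"
    by (simp add: XD_mult d\<kappa> dh2 XD_h2 x)
  finally show ?thesis
    using nz unfolding 1 by (simp add: \<kappa>_def field_simps)
qed

end

section \<open>The Yamabe equation and the monotone quantity Q\<close>

locale yamabe_coords = conformal_hessian U G u \<phi>
  for U :: "(real ^ 'n::finite) set" and G u \<phi> +
  fixes \<rho> :: real
  assumes scalar_eq: "x \<in> U \<Longrightarrow> scalar_coord G x = \<phi> x + \<rho>"
    and dim_ge_3: "CARD('n) \<ge> 3"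
begin

lemma vdiv_Y_eq:
  assumes x: "x \<in> U"
  shows "(real CARD('n) - 1) * vdiv Y x = - (XD \<phi> x / 2 + \<phi> x * (\<phi> x + \<rho>))"
proof -
  have "pd m (scalar_coord G) x = pd m \<phi> x" for m
  proof -
    have "pd m (scalar_coord G) x = pd m (\<lambda>y. \<phi> y + \<rho>) x"
      by (rule pd_cong_open[OF open_U x]) (simp add: scalar_eq)
    then show ?thesis by (simp add: pd_add diff_\<phi> x)
  qed
  then show ?thesis
    using vdiv_Y[OF x] by (simp add: scalar_eq x XD_def algebra_simps)
qed

definition B :: "real ^ 'n \<Rightarrow> real"
  where "B x = h2 x * (\<rho> / real CARD('n) - (\<phi> x + \<rho>) / (real CARD('n) - 2)) - 2 * (real CARD('n) - 1) / (real CARD('n) - 2) * XD \<phi> x"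

text \<open>The exponent is that of |du|^(n-2), halved because \<open>h2\<close> is the square.
  Since \<open>0 powr a = 0\<close>, Q vanishes at critical points whatever B is there.\<close>

definition Q :: "real ^ 'n \<Rightarrow> real"
  where "Q x = h2 x powr ((real CARD('n) - 2) / 2) * B x"

text \<open>The power remains continuous at zeros of \<open>h2\<close> because its exponent is
  positive, which is where n > 2 enters.\<close>

lemma continuous_Q: "continuous_on U Q"
  unfolding Q_def B_def using dim_ge_3 h2_nonneg
  by (intro continuous_intros continuous_on_powr' smooth_on_continuous_on[OF smooth_h2]
      smooth_on_continuous_on[OF smooth_\<phi>] smooth_on_continuous_on[OF smooth_XD_\<phi>]) auto

text \<open>The variables stand for n, p = \<phi>, r = \<rho>, h = |du|^2 and w = <d\<phi>, du>. The
  second derivative of \<phi> along the gradient has already been replaced through the Laplace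
  equation.\<close>

lemma soliton_algebra:
  fixes n p r h w :: real
  assumes "n \<noteq> 0" "n - 2 \<noteq> 0"
  shows "2 * p * h * (r / n - (p + r) / (n - 2)) - h * w / (n - 2)
      - 2 / (n - 2) * (- h * (w / 2 + p * (p + r)) - (n - 1) * (n - 2) * p * w)
      + (n - 2) * p * (h * (r / n - (p + r) / (n - 2)) - 2 * (n - 1) / (n - 2) * w) = - (h * p\<^sup>2)"
proof -
  \<comment> \<open>With the three reciprocals as unknowns, each bound by one polynomial relation,
    the claim becomes a polynomial consequence of these relations.\<close>
  define a b c where "a = inverse n" and "b = inverse (n - 2)" and "c = inverse (2::real)"
  have "a * n = 1" "b * (n - 2) = 1" "c * 2 = 1"
    using assms by (simp_all add: a_def b_def c_def)
  then have "2 * p * h * (r * a - (p + r) * b) - h * w * b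
      - 2 * b * (- h * (w * c + p * (p + r)) - (n - 1) * (n - 2) * p * w)
      + (n - 2) * p * (h * (r * a - (p + r) * b) - 2 * (n - 1) * b * w) = - (h * p\<^sup>2)"
    by algebra
  then show ?thesis
    unfolding divide_inverse a_def b_def c_def .
qed

text \<open>Since X|du|^2 = 2\<phi>|du|^2, the power in Q reproduces itself with factor (n-2)\<phi>.
  It remains to compute XB + (n-2)\<phi>B, where the Laplace equation removes the second derivative
  and the \<phi> <d\<phi>, du> terms cancel. The power is differentiable only off the critical set,
  hence the assumption on \<open>h2\<close>.\<close>

lemma
  assumes x: "x \<in> U" and nz: "h2 x \<noteq> 0"
  shows diff_Q: "Q differentiable at x"
    and XD_Q: "XD Q x = - (h2 x powr (real CARD('n) / 2) * (\<phi> x)\<^sup>2)"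
proof -
  have pos: "h2 x > 0" using nz h2_nonneg[OF x] by simp
  let ?a = "(real CARD('n) - 2) / 2"
  have d: "h2 differentiable at x" "\<phi> differentiable at x" "XD \<phi> differentiable at x"
    using smooth_h2 smooth_\<phi> smooth_XD_\<phi> smooth_on_differentiable x by blast+
  note pw = has_real_derivative_powr[OF pos, of ?a]
  define E where "E = h2 x powr ?a"
  have "h2 x powr (?a - 1) * h2 x = E"
    using pos by (simp add: E_def powr_diff)
  moreover have "XD (\<lambda>y. h2 y powr ?a) x = ?a * h2 x powr (?a - 1) * XD h2 x"
    unfolding XD_def pd_compose_real(2)[OF d(1) pw]
    by (simp add: sum_distrib_left sum_distrib_right mult_ac)
  ultimately have XE: "XD (\<lambda>y. h2 y powr ?a) x = (real CARD('n) - 2) * \<phi> x * E"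
    by (simp add: XD_h2[OF x] field_simps)
  have dE: "(\<lambda>y. h2 y powr ?a) differentiable at x"
    by (rule pd_compose_real(1)[OF d(1) pw])
  have dB: "B differentiable at x"
    unfolding B_def[abs_def] divide_inverse using d
    by (intro differentiable_diff differentiable_mult differentiable_add differentiable_const)
  show "Q differentiable at x"
    unfolding Q_def[abs_def] by (intro differentiable_mult dE dB)
  have n: "real CARD('n) - 2 \<noteq> 0" "real CARD('n) \<noteq> 0" using dim_ge_3 by auto
  have XB: "XD B x = 2 * \<phi> x * h2 x * (\<rho> / real CARD('n) - (\<phi> x + \<rho>) / (real CARD('n) - 2)) - h2 x * XD \<phi> x / (real CARD('n) - 2)
      - 2 * (real CARD('n) - 1) / (real CARD('n) - 2) * XD (XD \<phi>) x"
  proof -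
    have B': "B = (\<lambda>y. h2 y * (\<rho> / real CARD('n) - \<rho> / (real CARD('n) - 2) + (- 1 / (real CARD('n) - 2)) * \<phi> y) - 2 * (real CARD('n) - 1) / (real CARD('n) - 2) * XD \<phi> y)"
      by (rule ext) (simp add: B_def add_divide_distrib)
    have d': "(\<lambda>y. h2 y * (\<rho> / real CARD('n) - \<rho> / (real CARD('n) - 2) + (- 1 / (real CARD('n) - 2)) * \<phi> y)) differentiable at x"
      "(\<lambda>y. \<rho> / real CARD('n) - \<rho> / (real CARD('n) - 2) + (- 1 / (real CARD('n) - 2)) * \<phi> y) differentiable at x"
      "(\<lambda>y. (- 1 / (real CARD('n) - 2)) * \<phi> y) differentiable at x"
      "(\<lambda>y. 2 * (real CARD('n) - 1) / (real CARD('n) - 2) * XD \<phi> y) differentiable at x"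
      using d by (intro differentiable_mult differentiable_add differentiable_const; simp)+
    show ?thesis
      unfolding B' XD_diff[OF d'(1,4)] XD_mult[OF d(1) d'(2)] XD_add[OF differentiable_const d'(3)]
        XD_cmult[OF d(2)] XD_cmult[OF d(3)] XD_const XD_h2[OF x]
      by (simp add: divide_inverse algebra_simps)
  qed
  define \<Delta> where "\<Delta> = vdiv Y x"
  have \<Delta>: "(real CARD('n) - 1) * \<Delta> = - (XD \<phi> x / 2 + \<phi> x * (\<phi> x + \<rho>))"
    unfolding \<Delta>_def by (rule vdiv_Y_eq[OF x])
  \<comment> \<open>Multiplying by n - 1 lets \<open>\<Delta>\<close> be substituted without a
    division.\<close>
  have "(real CARD('n) - 1) * XD (XD \<phi>) x = h2 x * ((real CARD('n) - 1) * \<Delta>) - (real CARD('n) - 1) * (real CARD('n) - 2) * \<phi> x * XD \<phi> x"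
    unfolding XD_XD_\<phi>[OF x nz] \<Delta>_def by (simp add: algebra_simps)
  then have \<Delta>': "(real CARD('n) - 1) * XD (XD \<phi>) x =
      - h2 x * (XD \<phi> x / 2 + \<phi> x * (\<phi> x + \<rho>)) - (real CARD('n) - 1) * (real CARD('n) - 2) * \<phi> x * XD \<phi> x"
    unfolding \<Delta> by (simp add: algebra_simps)
  have "XD B x + (real CARD('n) - 2) * \<phi> x * B x = - (h2 x * (\<phi> x)\<^sup>2)"
  proof -
    have "XD B x = 2 * \<phi> x * h2 x * (\<rho> / real CARD('n) - (\<phi> x + \<rho>) / (real CARD('n) - 2)) - h2 x * XD \<phi> x / (real CARD('n) - 2)
      - 2 / (real CARD('n) - 2) * ((real CARD('n) - 1) * XD (XD \<phi>) x)"
      unfolding XB by simp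
    then have "XD B x = 2 * \<phi> x * h2 x * (\<rho> / real CARD('n) - (\<phi> x + \<rho>) / (real CARD('n) - 2)) - h2 x * XD \<phi> x / (real CARD('n) - 2)
      - 2 / (real CARD('n) - 2) * (- h2 x * (XD \<phi> x / 2 + \<phi> x * (\<phi> x + \<rho>)) - (real CARD('n) - 1) * (real CARD('n) - 2) * \<phi> x * XD \<phi> x)"
      unfolding \<Delta>' .
    then show ?thesis
      unfolding B_def by (simp only: soliton_algebra[OF n(2,1)])
  qed
  moreover have "XD Q x = E * (XD B x + (real CARD('n) - 2) * \<phi> x * B x)"
    unfolding Q_def[abs_def] XD_mult[OF dE dB] XE E_def by (simp add: algebra_simps)
  moreover have "h2 x powr (real CARD('n) / 2) = E * h2 x"
    using pos powr_add[of "h2 x" ?a 1] by (simp add: E_def diff_divide_distrib)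
  ultimately show "XD Q x = - (h2 x powr (real CARD('n) / 2) * (\<phi> x)\<^sup>2)"
    by simp
qed

text \<open>The derivative of Q along the gradient is only nonpositive, since \<phi> may vanish.
  Subtracting \<epsilon>u adds -\<epsilon>|du|^2 and makes it strictly negative, which no extremum
  permits.\<close>

lemma no_perturbed_extremum:
  assumes x: "x \<in> U" and nz: "h2 x \<noteq> 0" and "\<epsilon> > 0"
    and ext: "(\<forall>y\<in>U. Q y - \<epsilon> * u y \<le> Q x - \<epsilon> * u x) \<or> (\<forall>y\<in>U. Q x - \<epsilon> * u x \<le> Q y - \<epsilon> * u y)"
  shows False
proof -
  let ?F = "\<lambda>y. Q y - \<epsilon> * u y"
  have du: "u differentiable at x"
    using smooth_u smooth_on_differentiable x by blast
  then have du': "(\<lambda>y. \<epsilon> * u y) differentiable at x"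
    by (intro differentiable_mult differentiable_const)
  have "?F differentiable at x"
    by (rule differentiable_diff[OF diff_Q[OF x nz] du'])
  then have "frechet_derivative ?F (at x) = (\<lambda>v. 0)"
    using differential_zero_maxmin[OF x open_U _ ext] by (simp add: frechet_derivative_works)
  then have "XD ?F x = 0"
    by (simp add: XD_def pd_def)
  moreover have "XD ?F x = - (h2 x powr (real CARD('n) / 2) * (\<phi> x)\<^sup>2) - \<epsilon> * h2 x"
    unfolding XD_diff[OF diff_Q[OF x nz] du'] XD_cmult[OF du] XD_Q[OF x nz] h2_eq[OF x] ..
  moreover have "\<epsilon> * h2 x > 0"
    using nz h2_nonneg[OF x] \<open>\<epsilon> > 0\<close> by simp
  moreover have "h2 x powr (real CARD('n) / 2) * (\<phi> x)\<^sup>2 \<ge> 0" by simp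
  ultimately show False by linarith
qed

lemma \<phi>_eq_0:
  assumes Q0: "\<And>y. y \<in> U \<Longrightarrow> Q y = 0" and x: "x \<in> U"
  shows "\<phi> x = 0"
proof -
  have reg: "\<phi> y = 0" if y: "y \<in> U" and nz: "h2 y \<noteq> 0" for y
  proof -
    have "pd i Q y = pd i (\<lambda>y. 0) y" for i
      by (rule pd_cong_open[OF open_U y]) (rule Q0)
    then have "XD Q y = 0" by (simp add: XD_def)
    then show ?thesis using XD_Q[OF y nz] nz by simp
  qed
  show ?thesis
  proof (rule ccontr)
    assume nz: "\<phi> x \<noteq> 0"
    \<comment> \<open>On this open set every point is critical by \<open>reg\<close>, so du vanishes
      identically near x and the Hessian equation at x reads \<phi>G = 0.\<close>
    define V where "V = U \<inter> \<phi> -` (- {0})"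
    have V: "open V" "x \<in> V"
      using continuous_open_preimage[OF smooth_on_continuous_on[OF smooth_\<phi>] open_U, of "- {0}"]
        x nz by (auto simp: V_def)
    have du: "pd j u y = 0" if "y \<in> V" for y j
      using that reg[of y] h2_pos[of y j] unfolding V_def by force
    have "pd i (pd j u) x = pd i (\<lambda>y. 0) x" for i j
      by (rule pd_cong_open[OF V du])
    then have "\<phi> x * G x $ i $ j = 0" for i j
      using pd_pd_u[OF x, of i j] by (simp add: du V)
    then have "G x = 0" using nz by (simp add: vec_eq_iff)
    \<comment> \<open>Any nonzero vector contradicts positive definiteness; the index of the axis is
      arbitrary.\<close>
    then show False using pos_G[OF x, of "axis undefined 1"] by simp
  qed
qed

end

subsection \<open>Charts and coordinate vectors\<close>

locale atlas =
  fixes M :: "'a topology" and A :: "('a, 'n::finite) chart set"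
  assumes smooth_manifold: "smooth_manifold M A"
begin

context
  fixes c assumes c: "c \<in> A"
begin

lemma chart: "is_chart M c"
  using smooth_manifold c by (simp add: smooth_manifold_def)

lemma open_chart_img: "open (chart_img c)"
  using chart by (simp add: is_chart_def)

lemma openin_chart_dom: "openin M (chart_dom c)"
  using chart by (simp add: is_chart_def)

lemma chart_dom_subset: "chart_dom c \<subseteq> topspace M"
  by (rule openin_subset[OF openin_chart_dom])

lemma chart_homeomorphic:
  "homeomorphic_map (subtopology M (chart_dom c)) (top_of_set (chart_img c)) (snd c)"
  using chart by (simp add: is_chart_def)

lemma inj_on_chart: "inj_on (snd c) (chart_dom c)"
  using homeomorphic_imp_injective_map[OF chart_homeomorphic] chart_dom_subset
  by (simp add: Int_absorb1)

lemma param_chart: "p \<in> chart_dom c \<Longrightarrow> param c (snd c p) = p"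
  unfolding param_def by (rule inv_into_f_f[OF inj_on_chart])

lemma chart_param: "x \<in> chart_img c \<Longrightarrow> snd c (param c x) = x"
  unfolding param_def by (rule f_inv_into_f)

lemma param_in_dom: "x \<in> chart_img c \<Longrightarrow> param c x \<in> chart_dom c"
  unfolding param_def by (rule inv_into_into)

lemma openin_chart_preimage:
  assumes "open W"
  shows "openin M {p \<in> chart_dom c. snd c p \<in> W}"
proof -
  have "continuous_map (subtopology M (chart_dom c)) (top_of_set (chart_img c)) (snd c)"
    by (rule homeomorphic_imp_continuous_map[OF chart_homeomorphic])
  then have "openin (subtopology M (chart_dom c))
      {p \<in> topspace (subtopology M (chart_dom c)). snd c p \<in> chart_img c \<inter> W}"
    using assms by (intro openin_continuous_map_preimage) (auto simp: openin_open)
  moreover have "{p \<in> topspace (subtopology M (chart_dom c)). snd c p \<in> chart_img c \<inter> W} =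
      {p \<in> chart_dom c. snd c p \<in> W}"
    using chart_dom_subset by auto
  ultimately show ?thesis
    using openin_trans_full[OF _ openin_chart_dom] by metis
qed

lemma open_overlap:
  assumes d: "openin M D"
  shows "open (snd c ` (chart_dom c \<inter> D))"
proof -
  have "openin (subtopology M (chart_dom c)) (chart_dom c \<inter> D)"
    using d by (auto simp: openin_subtopology)
  then have "openin (top_of_set (chart_img c)) (snd c ` (chart_dom c \<inter> D))"
    using homeomorphic_imp_open_map[OF chart_homeomorphic] by (simp add: open_map_def)
  then show ?thesis
    using open_chart_img openin_open_eq by blast
qed

end

lemma topspace_charts: "topspace M = (\<Union>c\<in>A. chart_dom c)"
  using smooth_manifold by (simp add: smooth_manifold_def)

lemma smooth_transition:
  "c \<in> A \<Longrightarrow> d \<in> A \<Longrightarrow> smooth_on (snd c ` (chart_dom c \<inter> chart_dom d)) (snd d \<circ> param c)"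
  using smooth_manifold by (simp add: smooth_manifold_def)

section \<open>Smooth germs and coordinate vectors\<close>

lemma smooth_near_obtain:
  assumes "smooth_near A p h" "c \<in> A" "p \<in> chart_dom c"
  obtains W where "open W" "snd c p \<in> W" "W \<subseteq> chart_img c" "smooth_on W (h \<circ> param c)"
  using assms unfolding smooth_near_def by blast

lemma smooth_near_differentiable:
  assumes "smooth_near A p h" "c \<in> A" "p \<in> chart_dom c"
  shows "(h \<circ> param c) differentiable at (snd c p)"
  using smooth_near_obtain[OF assms] smooth_on_differentiable by metis

lemma smooth_near_lincomb:
  assumes "smooth_near A p h" "smooth_near A p k"
  shows "smooth_near A p (\<lambda>q. a * h q + b * k q)"
  unfolding smooth_near_def
proof (intro ballI impI)
  fix c assume c: "c \<in> A" "p \<in> chart_dom c"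
  obtain W where W: "open W" "snd c p \<in> W" "W \<subseteq> chart_img c" "smooth_on W (h \<circ> param c)"
    using smooth_near_obtain[OF assms(1) c] .
  obtain W' where W': "open W'" "snd c p \<in> W'" "smooth_on W' (k \<circ> param c)"
    using smooth_near_obtain[OF assms(2) c] .
  have "smooth_on (W \<inter> W') (\<lambda>x. a * (h \<circ> param c) x + b * (k \<circ> param c) x)"
    using W(1) W'(1) smooth_on_mono[OF W(4), of "W \<inter> W'"] smooth_on_mono[OF W'(3), of "W \<inter> W'"]
    by (intro smooth_on_add smooth_on_mult smooth_on_const open_Int) blast+
  then have "smooth_on (W \<inter> W') ((\<lambda>q. a * h q + b * k q) \<circ> param c)"
    by (simp add: comp_def)
  then show "\<exists>W. open W \<and> snd c p \<in> W \<and> W \<subseteq> chart_img c \<and> smooth_on W ((\<lambda>q. a * h q + b * k q) \<circ> param c)"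
    using W W' by (intro exI[of _ "W \<inter> W'"]) auto
qed

lemma smooth_near_mult:
  assumes "smooth_near A p h" "smooth_near A p k"
  shows "smooth_near A p (\<lambda>q. h q * k q)"
  unfolding smooth_near_def
proof (intro ballI impI)
  fix c assume c: "c \<in> A" "p \<in> chart_dom c"
  obtain W where W: "open W" "snd c p \<in> W" "W \<subseteq> chart_img c" "smooth_on W (h \<circ> param c)"
    using smooth_near_obtain[OF assms(1) c] .
  obtain W' where W': "open W'" "snd c p \<in> W'" "smooth_on W' (k \<circ> param c)"
    using smooth_near_obtain[OF assms(2) c] .
  have "smooth_on (W \<inter> W') (\<lambda>x. (h \<circ> param c) x * (k \<circ> param c) x)"
    using W(1) W'(1) smooth_on_mono[OF W(4), of "W \<inter> W'"] smooth_on_mono[OF W'(3), of "W \<inter> W'"]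
    by (intro smooth_on_mult open_Int) blast+
  then have "smooth_on (W \<inter> W') ((\<lambda>q. h q * k q) \<circ> param c)"
    by (simp add: comp_def)
  then show "\<exists>W. open W \<and> snd c p \<in> W \<and> W \<subseteq> chart_img c \<and> smooth_on W ((\<lambda>q. h q * k q) \<circ> param c)"
    using W W' by (intro exI[of _ "W \<inter> W'"]) auto
qed

lemma coord_vec_eq:
  "smooth_near A p h \<Longrightarrow> coord_vec A c i p h = pd i (h \<circ> param c) (snd c p)"
  by (simp add: coord_vec_def)

lemma coord_vec_tangent:
  assumes c: "c \<in> A" "p \<in> chart_dom c"
  shows "coord_vec A c i p \<in> tangent_space A p"
proof -
  have "coord_vec A c i p (\<lambda>q. a * h q + b * k q) = a * coord_vec A c i p h + b * coord_vec A c i p k"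
    if hk: "smooth_near A p h" "smooth_near A p k" for h k a b
  proof -
    note d = smooth_near_differentiable[OF hk(1) c] smooth_near_differentiable[OF hk(2) c]
    have d': "(\<lambda>x. a * (h \<circ> param c) x) differentiable at (snd c p)"
      "(\<lambda>x. b * (k \<circ> param c) x) differentiable at (snd c p)"
      by (intro differentiable_mult differentiable_const d)+
    have "(\<lambda>q. a * h q + b * k q) \<circ> param c = (\<lambda>x. a * (h \<circ> param c) x + b * (k \<circ> param c) x)"
      by (simp add: comp_def)
    then show ?thesis
      by (simp only: coord_vec_eq hk smooth_near_lincomb pd_add[OF d'] pd_cmult[OF d(1)] pd_cmult[OF d(2)])
  qed
  moreover have "coord_vec A c i p (\<lambda>q. h q * k q) = h p * coord_vec A c i p k + k p * coord_vec A c i p h"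
    if hk: "smooth_near A p h" "smooth_near A p k" for h k
  proof -
    note d = smooth_near_differentiable[OF hk(1) c] smooth_near_differentiable[OF hk(2) c]
    have "(\<lambda>q. h q * k q) \<circ> param c = (\<lambda>x. (h \<circ> param c) x * (k \<circ> param c) x)"
      by (simp add: comp_def)
    then show ?thesis
      by (simp only: coord_vec_eq hk smooth_near_mult pd_mult[OF d])
        (simp add: param_chart c)
  qed
  ultimately show ?thesis
    unfolding tangent_space_def by (simp add: coord_vec_def)
qed

lemma tangent_sum:
  assumes "\<And>i. i \<in> I \<Longrightarrow> V i \<in> tangent_space A p"
  shows "(\<lambda>h. \<Sum>i\<in>I. v i * V i h) \<in> tangent_space A p"
proof -
  have V: "V i (\<lambda>q. a * h q + b * k q) = a * V i h + b * V i k"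
    "V i (\<lambda>q. h q * k q) = h p * V i k + k p * V i h"
    if "i \<in> I" "smooth_near A p h" "smooth_near A p k" for i h k a b
    using assms that unfolding tangent_space_def by blast+
  have V0: "V i h = 0" if "i \<in> I" "\<not> smooth_near A p h" for i h
    using assms that unfolding tangent_space_def by blast
  show ?thesis
    unfolding tangent_space_def
    by (simp add: V V0 distrib_left sum.distrib sum_distrib_left mult_ac)
qed

text \<open>The chain rule along the transition map; the coefficients J are its partial derivatives
  in direction i.\<close>

lemma coord_vec_change:
  assumes c: "c \<in> A" "p \<in> chart_dom c" and d: "d \<in> A" "p \<in> chart_dom d"
  obtains J where "coord_vec A c i p = (\<lambda>h. \<Sum>k\<in>UNIV. J k * coord_vec A d k p h)"
proof
  let ?N = "snd c ` (chart_dom c \<inter> chart_dom d)" and ?t = "snd d \<circ> param c" and ?x = "snd c p"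
  show "coord_vec A c i p = (\<lambda>h. \<Sum>k\<in>UNIV. (pd i ?t ?x $ k) * coord_vec A d k p h)"
  proof (rule ext)
    fix h
    show "coord_vec A c i p h = (\<Sum>k\<in>UNIV. (pd i ?t ?x $ k) * coord_vec A d k p h)"
    proof (cases "smooth_near A p h")
      case True
      have N: "open ?N" "?x \<in> ?N"
        using c d by (auto intro: open_overlap openin_chart_dom)
      have tx: "?t ?x = snd d p" using c by (simp add: param_chart)
      have "pd i (h \<circ> param c) ?x = pd i (\<lambda>y. (h \<circ> param d) (?t y)) ?x"
        by (rule pd_cong_open[OF N]) (use c d in \<open>auto simp: param_chart\<close>)
      also have "\<dots> = (\<Sum>k\<in>UNIV. (pd i ?t ?x $ k) * pd k (h \<circ> param d) (?t ?x))"
      proof (rule pd_chain)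
        show "?t differentiable at ?x"
          by (rule smooth_on_differentiable[OF smooth_transition[OF c(1) d(1)] N(2)])
        show "h \<circ> param d differentiable at (?t ?x)"
          unfolding tx by (rule smooth_near_differentiable[OF True d])
      qed
      finally show ?thesis by (simp only: coord_vec_eq[OF True] tx)
    qed (simp add: coord_vec_def)
  qed
qed

lemma coordinate_smooth_near:
  assumes c: "c \<in> A" "p \<in> chart_dom c"
  shows "smooth_near A p (\<lambda>q. snd c q $ j)"
  unfolding smooth_near_def
proof (intro ballI impI)
  fix d assume d: "d \<in> A" "p \<in> chart_dom d"
  let ?N = "snd d ` (chart_dom d \<inter> chart_dom c)"
  have N: "open ?N" using c d by (intro open_overlap openin_chart_dom)
  have "smooth_on ?N (\<lambda>x. (snd c \<circ> param d) x $ j)"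
    by (rule smooth_on_nth[OF N smooth_transition[OF d(1) c(1)]])
  then show "\<exists>W. open W \<and> snd d p \<in> W \<and> W \<subseteq> chart_img d \<and> smooth_on W ((\<lambda>q. snd c q $ j) \<circ> param d)"
    using N c d by (intro exI[of _ ?N]) (auto simp: comp_def)
qed

text \<open>The coordinate functions read off the coefficients of a combination of coordinate
  vectors. Hence a combination with a nonzero coefficient is a nonzero derivation, and positivity of
  the metric passes to its matrix.\<close>

lemma coord_vec_coordinate:
  assumes c: "c \<in> A" "p \<in> chart_dom c"
  shows "coord_vec A c i p (\<lambda>q. snd c q $ j) = (if i = j then 1 else 0)"
proof -
  have "pd i ((\<lambda>q. snd c q $ j) \<circ> param c) (snd c p) = pd i (\<lambda>x. x $ j) (snd c p)"
    by (rule pd_cong_open[OF open_chart_img[OF c(1)]]) (use c in \<open>auto simp: chart_param\<close>)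
  also have "\<dots> = axis i 1 $ j"
    by (rule pd_eqI) (rule bounded_linear.has_derivative[OF bounded_linear_vec_nth], simp)
  finally show ?thesis
    using coord_vec_eq[OF coordinate_smooth_near[OF c]] by (simp add: axis_def)
qed

lemma continuous_map_charts:
  assumes "\<And>c. c \<in> A \<Longrightarrow> continuous_on (chart_img c) (F \<circ> param c)"
  shows "continuous_map M euclideanreal F"
  unfolding continuous_map
proof (intro conjI allI impI)
  fix V :: "real set" assume "openin euclidean V"
  then have V: "open V" by simp
  have "openin M {p \<in> chart_dom c. F p \<in> V}" if c: "c \<in> A" for c
  proof -
    have "{p \<in> chart_dom c. F p \<in> V} = {p \<in> chart_dom c. snd c p \<in> chart_img c \<inter> (F \<circ> param c) -` V}"
      by (auto simp: param_chart[OF c] dest: inj_onD[OF inj_on_chart[OF c]])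
    then show ?thesis
      using openin_chart_preimage[OF c continuous_open_preimage[OF assms[OF c] open_chart_img[OF c] V]]
      by simp
  qed
  then have "openin M (\<Union>c\<in>A. {p \<in> chart_dom c. F p \<in> V})" by blast
  moreover have "{p \<in> topspace M. F p \<in> V} = (\<Union>c\<in>A. {p \<in> chart_dom c. F p \<in> V})"
    unfolding topspace_charts by blast
  ultimately show "openin M {p \<in> topspace M. F p \<in> V}" by simp
qed simp

end

subsection \<open>Riemannian metrics on manifolds\<close>

locale riemannian_manifold = atlas M A
  for M :: "'a topology" and A :: "('a, 'n::finite) chart set" +
  fixes g :: "'a \<Rightarrow> (('a \<Rightarrow> real) \<Rightarrow> real) \<Rightarrow> (('a \<Rightarrow> real) \<Rightarrow> real) \<Rightarrow> real"
  assumes metric: "riemannian_metric A g"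
begin

abbreviation gc :: "('a, 'n) chart \<Rightarrow> real ^ 'n \<Rightarrow> real ^ 'n ^ 'n"
  where "gc \<equiv> metric_comp A g"

lemma
  assumes "c \<in> A" "p \<in> chart_dom c"
  shows metric_sym: "V \<in> tangent_space A p \<Longrightarrow> W \<in> tangent_space A p \<Longrightarrow> g p V W = g p W V"
    and metric_lincomb: "V \<in> tangent_space A p \<Longrightarrow> W \<in> tangent_space A p \<Longrightarrow> Z \<in> tangent_space A p \<Longrightarrow>
      g p (\<lambda>h. a * V h + b * W h) Z = a * g p V Z + b * g p W Z"
    and metric_pos: "V \<in> tangent_space A p \<Longrightarrow> V \<noteq> (\<lambda>h. 0) \<Longrightarrow> g p V V > 0"
  using metric assms unfolding riemannian_metric_def by blast+

lemma metric_sum_left: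
  assumes p: "c \<in> A" "p \<in> chart_dom c" and "finite I" "\<And>i. i \<in> I \<Longrightarrow> V i \<in> tangent_space A p"
    and Z: "Z \<in> tangent_space A p"
  shows "g p (\<lambda>h. \<Sum>i\<in>I. v i * V i h) Z = (\<Sum>i\<in>I. v i * g p (V i) Z)"
  using assms(3,4)
proof (induction I)
  case empty
  \<comment> \<open>Linearity with both coefficients 0 evaluates the metric on the zero
    derivation.\<close>
  then show ?case using metric_lincomb[OF p Z Z Z, of 0 0] by simp
next
  case (insert i I)
  have "g p (\<lambda>h. v i * V i h + 1 * (\<Sum>i\<in>I. v i * V i h)) Z =
      v i * g p (V i) Z + 1 * g p (\<lambda>h. \<Sum>i\<in>I. v i * V i h) Z"
    using insert.prems by (intro metric_lincomb[OF p] tangent_sum Z) auto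
  then show ?case using insert by simp
qed

lemma metric_sum_right:
  assumes p: "c \<in> A" "p \<in> chart_dom c" and "finite I" "\<And>i. i \<in> I \<Longrightarrow> V i \<in> tangent_space A p"
    and Z: "Z \<in> tangent_space A p"
  shows "g p Z (\<lambda>h. \<Sum>i\<in>I. v i * V i h) = (\<Sum>i\<in>I. v i * g p Z (V i))"
proof -
  have "(\<lambda>h. \<Sum>i\<in>I. v i * V i h) \<in> tangent_space A p"
    by (rule tangent_sum) (rule assms(4))
  then have "g p Z (\<lambda>h. \<Sum>i\<in>I. v i * V i h) = (\<Sum>i\<in>I. v i * g p (V i) Z)"
    using metric_sym[OF p Z] metric_sum_left[OF p assms(3,4) Z] by simp
  also have "\<dots> = (\<Sum>i\<in>I. v i * g p Z (V i))"
    by (intro sum.cong refl) (simp add: metric_sym[OF p Z assms(4)])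
  finally show ?thesis .
qed

lemma metric_comp_nth:
  "c \<in> A \<Longrightarrow> p \<in> chart_dom c \<Longrightarrow> gc c (snd c p) $ i $ j = g p (coord_vec A c i p) (coord_vec A c j p)"
  by (simp add: metric_comp_def param_chart)

lemma riemannian_coords_chart:
  assumes c: "c \<in> A"
  shows "riemannian_coords (chart_img c) (gc c)"
proof
  show "open (chart_img c)" by (rule open_chart_img[OF c])
  show "smooth_mat (chart_img c) (gc c)"
    using metric c by (simp add: riemannian_metric_def smooth_mat_def)
next
  fix x assume "x \<in> chart_img c"
  then obtain p where p: "p \<in> chart_dom c" "x = snd c p" by auto
  note tv = coord_vec_tangent[OF c p(1)]
  have "gc c x $ i $ j = gc c x $ j $ i" for i j
    unfolding p(2) metric_comp_nth[OF c p(1)] by (rule metric_sym[OF c p(1) tv tv])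
  then show "transpose (gc c x) = gc c x"
    by (simp add: vec_eq_iff transpose_def)
  fix v :: "real ^ 'n" assume "v \<noteq> 0"
  then obtain j where j: "v $ j \<noteq> 0" by (auto simp: vec_eq_iff)
  let ?V = "\<lambda>h. \<Sum>i\<in>UNIV. v $ i * coord_vec A c i p h"
  have V: "?V \<in> tangent_space A p" by (rule tangent_sum[OF tv])
  have "?V (\<lambda>q. snd c q $ j) = v $ j"
    by (simp add: coord_vec_coordinate[OF c p(1)] if_distrib cong: if_cong)
  then have "?V \<noteq> (\<lambda>h. 0)"
    using j fun_cong[of ?V "\<lambda>h. 0" "\<lambda>q. snd c q $ j"] by linarith
  then have "g p ?V ?V > 0" by (rule metric_pos[OF c p(1) V])
  also have "g p ?V ?V = (\<Sum>i\<in>UNIV. v $ i * (\<Sum>j\<in>UNIV. v $ j * g p (coord_vec A c i p) (coord_vec A c j p)))"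
    by (simp add: metric_sum_left[OF c p(1) _ tv V] metric_sum_right[OF c p(1) _ tv tv])
  also have "\<dots> = v \<bullet> (gc c x *v v)"
    using c p by (simp add: inner_vec_def matrix_vector_mult_def metric_comp_nth mult.commute)
  finally show "v \<bullet> (gc c x *v v) > 0" .
qed

section \<open>Gradients and chart independence of inner products\<close>

lemma ginner_sym:
  assumes c: "c \<in> A" "x \<in> chart_img c"
  shows "ginner (gc c) u v x = ginner (gc c) v u x"
proof -
  interpret riemannian_coords "chart_img c" "gc c" by (rule riemannian_coords_chart[OF c(1)])
  have "ginner (gc c) u v x = (\<Sum>j\<in>UNIV. \<Sum>i\<in>UNIV. H x $ i $ j * pd i u x * pd j v x)"
    unfolding ginner_def H_def[symmetric] by (rule sum.swap)
  then show ?thesis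
    unfolding ginner_def H_def[symmetric] by (simp add: H_swap[OF c(2)] mult_ac)
qed

text \<open>The gradient as a derivation, built from the components in the chart c. Different charts
  are compared only through its pairing with coordinate vectors.\<close>

definition grad :: "('a, 'n) chart \<Rightarrow> ('a \<Rightarrow> real) \<Rightarrow> 'a \<Rightarrow> ('a \<Rightarrow> real) \<Rightarrow> real"
  where "grad c u p h = (\<Sum>i\<in>UNIV. (\<Sum>k\<in>UNIV. matrix_inv (gc c (snd c p)) $ i $ k *
    pd k (u \<circ> param c) (snd c p)) * coord_vec A c i p h)"

lemma grad_tangent: "c \<in> A \<Longrightarrow> p \<in> chart_dom c \<Longrightarrow> grad c u p \<in> tangent_space A p"
  unfolding grad_def[abs_def] by (rule tangent_sum[OF coord_vec_tangent])

lemma grad_apply: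
  assumes c: "c \<in> A" "p \<in> chart_dom c" and v: "smooth_near A p v"
  shows "grad c u p v = ginner (gc c) (u \<circ> param c) (v \<circ> param c) (snd c p)"
proof -
  have "grad c u p v = ginner (gc c) (v \<circ> param c) (u \<circ> param c) (snd c p)"
    by (simp add: grad_def ginner_def coord_vec_eq[OF v] sum_distrib_left sum_distrib_right mult_ac)
  then show ?thesis using c by (simp add: ginner_sym)
qed

lemma metric_grad_same:
  assumes c: "c \<in> A" "p \<in> chart_dom c" and u: "smooth_near A p u"
  shows "g p (grad c u p) (coord_vec A c j p) = coord_vec A c j p u"
proof -
  interpret riemannian_coords "chart_img c" "gc c" by (rule riemannian_coords_chart[OF c(1)])
  let ?x = "snd c p" and ?w = "(\<chi> k. pd k (u \<circ> param c) (snd c p))"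
  have x: "?x \<in> chart_img c" using c by simp
  note tv = coord_vec_tangent[OF c]
  have "g p (grad c u p) (coord_vec A c j p) = (\<Sum>i\<in>UNIV. (H ?x *v ?w) $ i * gc c ?x $ i $ j)"
    unfolding grad_def[abs_def]
    by (simp add: metric_sum_left[OF c _ tv tv] metric_comp_nth c matrix_vector_mult_def H_def)
  also have "\<dots> = (gc c ?x *v (H ?x *v ?w)) $ j"
    by (simp add: matrix_vector_mult_def[of "gc c ?x"] G_swap[OF x, of _ j] mult.commute)
  also have "\<dots> = ?w $ j"
    by (simp add: matrix_vector_mul_assoc G_H x)
  finally show ?thesis by (simp add: coord_vec_eq[OF u])
qed

lemma metric_grad:
  assumes c: "c \<in> A" "p \<in> chart_dom c" and d: "d \<in> A" "p \<in> chart_dom d" and u: "smooth_near A p u"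
  shows "g p (grad c u p) (coord_vec A d k p) = coord_vec A d k p u"
proof -
  obtain J where J: "coord_vec A d k p = (\<lambda>h. \<Sum>i\<in>UNIV. J i * coord_vec A c i p h)"
    using coord_vec_change[OF d c] .
  show ?thesis
    unfolding J
    by (simp add: metric_sum_right[OF c _ coord_vec_tangent[OF c] grad_tangent[OF c]] metric_grad_same[OF c u])
qed

text \<open>The metric product of the gradient of u from chart c with that of v from chart d is
  evaluated in two ways. It is the derivative of u along the second and of v along the first, and
  these are the two sides. No transformation rule for metric components is needed.\<close>

lemma ginner_chart_indep:
  assumes c: "c \<in> A" "p \<in> chart_dom c" and d: "d \<in> A" "p \<in> chart_dom d"
    and u: "smooth_near A p u" and v: "smooth_near A p v"
  shows "ginner (gc c) (u \<circ> param c) (v \<circ> param c) (snd c p) =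
    ginner (gc d) (u \<circ> param d) (v \<circ> param d) (snd d p)"
proof -
  have *: "g p (grad c u p) (grad d v p) = grad d v p u"
    if "c \<in> A" "p \<in> chart_dom c" "d \<in> A" "p \<in> chart_dom d" "smooth_near A p u" for c d u v
    unfolding grad_def[of d, abs_def]
    by (simp add: metric_sum_right[OF that(3,4) _ coord_vec_tangent[OF that(3,4)] grad_tangent[OF that(1,2)]]
        metric_grad[OF that])
  have "grad c u p v = grad d v p u"
    using *[OF c d u, of v] *[OF d c v, of u] metric_sym[OF c grad_tangent[OF c] grad_tangent[OF d], of u v]
    by simp
  then show ?thesis
    using d by (simp add: grad_apply[OF c v] grad_apply[OF d u] ginner_sym[of d])
qed

end

subsection \<open>Compact Yamabe solitons\<close>

text \<open>At a maximum p of q + \<epsilon>f the value of q is 0, so q is bounded everywhere by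
  \<epsilon> times the oscillation of f; this is below any positive value of q once \<epsilon> is
  small.\<close>

lemma compact_nonpos_by_perturbation:
  assumes M: "compact_space M" and q: "continuous_map M euclideanreal q"
    and f: "continuous_map M euclideanreal f"
    and max: "\<And>\<epsilon> p. \<epsilon> > 0 \<Longrightarrow> p \<in> topspace M \<Longrightarrow>
      (\<And>r. r \<in> topspace M \<Longrightarrow> q r + \<epsilon> * f r \<le> q p + \<epsilon> * f p) \<Longrightarrow> q p = 0"
    and r: "r \<in> topspace M"
  shows "q r \<le> 0"
proof (rule ccontr)
  assume neg: "\<not> ?thesis"
  have "compact (f ` topspace M)"
    using image_compactin[OF M[unfolded compact_space_def] f] by simp
  then obtain K where K: "K > 0" "\<And>p. p \<in> topspace M \<Longrightarrow> \<bar>f p\<bar> \<le> K"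
    using compact_imp_bounded bounded_pos by (metis (no_types, lifting) image_eqI real_norm_def)
  \<comment> \<open>The oscillation of f is at most 2K, so this choice bounds q r by two thirds of
    itself.\<close>
  define \<epsilon> where "\<epsilon> = q r / (3 * K)"
  have \<epsilon>: "\<epsilon> > 0" using neg K by (simp add: \<epsilon>_def)
  let ?F = "\<lambda>p. q p + \<epsilon> * f p"
  have "continuous_map M euclideanreal ?F"
    by (intro continuous_intros q f)
  from image_compactin[OF M[unfolded compact_space_def] this] have "compact (?F ` topspace M)"
    by simp
  moreover have "?F ` topspace M \<noteq> {}" using r by blast
  ultimately obtain m where "m \<in> ?F ` topspace M" "\<forall>t\<in>?F ` topspace M. t \<le> m"
    using compact_attains_sup by metis
  then obtain p where p: "p \<in> topspace M" "\<And>s. s \<in> topspace M \<Longrightarrow> ?F s \<le> ?F p"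
    by blast
  have "q p = 0" by (rule max[OF \<epsilon> p])
  then have "q r \<le> \<epsilon> * (f p - f r)"
    using p(2)[OF r] by (simp add: algebra_simps)
  also have "\<dots> \<le> \<epsilon> * (2 * K)"
    using K(2)[OF p(1)] K(2)[OF r] \<epsilon> by (intro mult_left_mono) auto
  also have "\<dots> < q r"
    using neg K by (simp add: \<epsilon>_def)
  finally show False by simp
qed

locale yamabe_soliton = riemannian_manifold M A g
  for M :: "'a topology" and A :: "('a, 'n::finite) chart set" and g +
  fixes f :: "'a \<Rightarrow> real" and \<rho> :: real
  assumes dim3: "CARD('n) \<ge> 3"
    and smooth_f: "smooth_fun A f"
    and soliton: "c \<in> A \<Longrightarrow> p \<in> chart_dom c \<Longrightarrow>
      (scalar_curvature A g c p - \<rho>) * metric_comp A g c (snd c p) $ i $ j = hessian A g c f i j p"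
begin

text \<open>The chart remains an argument because agreement between charts is established beforehand
  only at regular points of f.\<close>

definition \<phi> :: "('a, 'n) chart \<Rightarrow> real ^ 'n \<Rightarrow> real"
  where "\<phi> c x = scalar_coord (gc c) x - \<rho>"

lemma yamabe_coords_chart:
  assumes c: "c \<in> A"
  shows "yamabe_coords (chart_img c) (gc c) (f \<circ> param c) (\<phi> c) \<rho>"
proof -
  interpret riemannian_coords "chart_img c" "gc c" by (rule riemannian_coords_chart[OF c])
  show ?thesis
  proof
    show "smooth_on (chart_img c) (f \<circ> param c)"
      using smooth_f c by (simp add: smooth_fun_def)
    show "smooth_on (chart_img c) (\<phi> c)"
      unfolding \<phi>_def[abs_def] by (intro smooth_on_diff smooth_on_const smooth_scalar open_U)
    show "CARD('n) \<ge> 3" by (rule dim3)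
  next
    fix x assume "x \<in> chart_img c"
    then obtain p where p: "p \<in> chart_dom c" "x = snd c p" by auto
    show "\<phi> c x * gc c x $ i $ j = hessian_coord (gc c) (f \<circ> param c) i j x" for i j
      using soliton[OF c p(1), of i j] by (simp add: \<phi>_def scalar_curvature_def hessian_def p)
    show "scalar_coord (gc c) x = \<phi> c x + \<rho>" by (simp add: \<phi>_def)
  qed
qed

lemma smooth_near_f: "smooth_near A p f"
  unfolding smooth_near_def
  using smooth_f open_chart_img unfolding smooth_fun_def by blast

definition chart_at :: "'a \<Rightarrow> ('a, 'n) chart"
  where "chart_at p = (SOME c. c \<in> A \<and> p \<in> chart_dom c)"

lemma chart_at:
  assumes "c \<in> A" "p \<in> chart_dom c"
  shows "chart_at p \<in> A" "p \<in> chart_dom (chart_at p)"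
  using someI[of "\<lambda>c. c \<in> A \<and> p \<in> chart_dom c" c] assms by (auto simp: chart_at_def)

definition h2 :: "'a \<Rightarrow> real"
  where "h2 p = (let c = chart_at p in ginner (gc c) (f \<circ> param c) (f \<circ> param c) (snd c p))"

lemma h2_chart:
  assumes "c \<in> A" "p \<in> chart_dom c"
  shows "h2 p = ginner (gc c) (f \<circ> param c) (f \<circ> param c) (snd c p)"
  unfolding h2_def Let_def
  by (rule ginner_chart_indep[OF chart_at[OF assms] assms smooth_near_f smooth_near_f])

lemma h2_param:
  "c \<in> A \<Longrightarrow> x \<in> chart_img c \<Longrightarrow> h2 (param c x) = ginner (gc c) (f \<circ> param c) (f \<circ> param c) x"
  by (simp add: h2_chart param_in_dom chart_param)

text \<open>This admits |df|^2 itself as an argument of \<open>ginner_chart_indep\<close>.\<close>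

lemma smooth_near_h2: "smooth_near A p h2"
  unfolding smooth_near_def
proof (intro ballI impI)
  fix c assume c: "c \<in> A" "p \<in> chart_dom c"
  interpret C: yamabe_coords "chart_img c" "gc c" "f \<circ> param c" "\<phi> c" \<rho>
    by (rule yamabe_coords_chart[OF c(1)])
  have "smooth_on (chart_img c) (h2 \<circ> param c)"
    by (rule smooth_on_cong[OF C.open_U _ C.smooth_h2]) (simp add: h2_param[OF c(1)] C.h2_def)
  then show "\<exists>W. open W \<and> snd c p \<in> W \<and> W \<subseteq> chart_img c \<and> smooth_on W (h2 \<circ> param c)"
    using C.open_U c by (intro exI[of _ "chart_img c"]) auto
qed

text \<open>At regular points of \<open>f\<close> the scalar curvature is recovered from
  $\langle\nabla|\nabla f|^2,\nabla f\rangle = 2\varphi|\nabla f|^2$, which involves only the metric.\<close>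

lemma \<phi>_chart_indep:
  assumes c: "c \<in> A" "p \<in> chart_dom c" and d: "d \<in> A" "p \<in> chart_dom d" and nz: "h2 p \<noteq> 0"
  shows "\<phi> c (snd c p) = \<phi> d (snd d p)"
proof -
  have *: "ginner (gc c) (h2 \<circ> param c) (f \<circ> param c) (snd c p) = 2 * \<phi> c (snd c p) * h2 p"
    if c: "c \<in> A" "p \<in> chart_dom c" for c
  proof -
    interpret C: yamabe_coords "chart_img c" "gc c" "f \<circ> param c" "\<phi> c" \<rho>
      by (rule yamabe_coords_chart[OF c(1)])
    have x: "snd c p \<in> chart_img c" using c by simp
    have "ginner (gc c) (h2 \<circ> param c) (f \<circ> param c) (snd c p) =
        ginner (gc c) C.h2 (f \<circ> param c) (snd c p)"
      by (rule ginner_cong_open[OF C.open_U x]) (simp_all add: h2_param[OF c(1)] C.h2_def)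
    also have "\<dots> = 2 * \<phi> c (snd c p) * C.h2 (snd c p)"
      by (simp only: C.ginner_u_right[OF x] C.XD_h2[OF x])
    also have "C.h2 (snd c p) = h2 p"
      by (simp add: C.h2_def h2_chart[OF c])
    finally show ?thesis .
  qed
  show ?thesis
    using ginner_chart_indep[OF c d smooth_near_h2 smooth_near_f] nz
    unfolding *[OF c] *[OF d] by simp
qed

definition \<Phi> :: "'a \<Rightarrow> real"
  where "\<Phi> p = (let c = chart_at p in \<phi> c (snd c p))"

lemma \<Phi>_chart:
  assumes "c \<in> A" "p \<in> chart_dom c" "h2 p \<noteq> 0"
  shows "\<Phi> p = \<phi> c (snd c p)"
  unfolding \<Phi>_def Let_def by (rule \<phi>_chart_indep[OF chart_at[OF assms(1,2)] assms])

text \<open>Agreement at p alone would not identify derivatives of \<open>\<Phi>\<close> with those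
  of \<open>\<phi> c\<close>; it extends to a neighbourhood because the regular set is open.\<close>

lemma regular_nbhd:
  assumes c: "c \<in> A" "p \<in> chart_dom c" and nz: "h2 p \<noteq> 0"
  obtains W where "open W" "snd c p \<in> W" "W \<subseteq> chart_img c" "\<And>x. x \<in> W \<Longrightarrow> (\<Phi> \<circ> param c) x = \<phi> c x"
proof
  interpret C: yamabe_coords "chart_img c" "gc c" "f \<circ> param c" "\<phi> c" \<rho>
    by (rule yamabe_coords_chart[OF c(1)])
  let ?W = "chart_img c \<inter> C.h2 -` (- {0})"
  show "open ?W"
    by (rule continuous_open_preimage[OF smooth_on_continuous_on[OF C.smooth_h2] C.open_U]) auto
  show "snd c p \<in> ?W" "?W \<subseteq> chart_img c"
    using c nz by (auto simp: h2_chart C.h2_def)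
  show "(\<Phi> \<circ> param c) x = \<phi> c x" if "x \<in> ?W" for x
    using that c \<Phi>_chart[of c "param c x"] by (auto simp: h2_param C.h2_def param_in_dom chart_param)
qed

lemma smooth_near_\<Phi>:
  assumes nz: "h2 p \<noteq> 0"
  shows "smooth_near A p \<Phi>"
  unfolding smooth_near_def
proof (intro ballI impI)
  fix c assume c: "c \<in> A" "p \<in> chart_dom c"
  interpret C: yamabe_coords "chart_img c" "gc c" "f \<circ> param c" "\<phi> c" \<rho>
    by (rule yamabe_coords_chart[OF c(1)])
  obtain W where W: "open W" "snd c p \<in> W" "W \<subseteq> chart_img c"
    "\<And>x. x \<in> W \<Longrightarrow> (\<Phi> \<circ> param c) x = \<phi> c x"
    by (rule regular_nbhd[OF c nz]) blast
  have "smooth_on W (\<Phi> \<circ> param c)"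
    by (rule smooth_on_cong[OF W(1) _ smooth_on_mono[OF C.smooth_\<phi> W(3)]]) (simp add: W(4)[symmetric])
  then show "\<exists>W. open W \<and> snd c p \<in> W \<and> W \<subseteq> chart_img c \<and> smooth_on W (\<Phi> \<circ> param c)"
    using W by blast
qed

abbreviation Qc :: "('a, 'n) chart \<Rightarrow> real ^ 'n \<Rightarrow> real"
  where "Qc c \<equiv> yamabe_coords.Q (gc c) (f \<circ> param c) (\<phi> c) \<rho>"

lemma Qc_eq:
  assumes c: "c \<in> A" "p \<in> chart_dom c"
  shows "Qc c (snd c p) = h2 p powr ((real CARD('n) - 2) / 2) *
    (h2 p * (\<rho> / real CARD('n) - (\<phi> c (snd c p) + \<rho>) / (real CARD('n) - 2)) -
     2 * (real CARD('n) - 1) / (real CARD('n) - 2) * ginner (gc c) (\<phi> c) (f \<circ> param c) (snd c p))"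
proof -
  interpret C: yamabe_coords "chart_img c" "gc c" "f \<circ> param c" "\<phi> c" \<rho>
    by (rule yamabe_coords_chart[OF c(1)])
  show ?thesis
    using c by (simp add: C.Q_def C.B_def h2_chart C.h2_def C.ginner_u_right)
qed

text \<open>At a critical point the values of \<open>\<phi>\<close> in the two charts cannot be
  compared, but the power factor is zero in both. At a regular point everything is expressed by
  inner products of differentials of \<open>f\<close> and \<open>\<Phi>\<close>.\<close>

lemma Qc_chart_indep:
  assumes c: "c \<in> A" "p \<in> chart_dom c" and d: "d \<in> A" "p \<in> chart_dom d"
  shows "Qc c (snd c p) = Qc d (snd d p)"
proof (cases "h2 p = 0")
  case True
  then show ?thesis by (simp add: Qc_eq c d)
next
  case False
  have *: "ginner (gc c) (\<phi> c) (f \<circ> param c) (snd c p) =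
      ginner (gc c) (\<Phi> \<circ> param c) (f \<circ> param c) (snd c p)"
    if c: "c \<in> A" "p \<in> chart_dom c" for c
  proof -
    obtain W where W: "open W" "snd c p \<in> W" "W \<subseteq> chart_img c"
      "\<And>x. x \<in> W \<Longrightarrow> (\<Phi> \<circ> param c) x = \<phi> c x"
      by (rule regular_nbhd[OF c False]) blast
    show ?thesis by (rule ginner_cong_open[OF W(1,2)]) (simp_all add: W(4)[symmetric])
  qed
  show ?thesis
    unfolding Qc_eq[OF c] Qc_eq[OF d] *[OF c] *[OF d] \<phi>_chart_indep[OF c d False]
      ginner_chart_indep[OF c d smooth_near_\<Phi>[OF False] smooth_near_f] ..
qed

definition Q :: "'a \<Rightarrow> real"
  where "Q p = (let c = chart_at p in Qc c (snd c p))"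

lemma Q_chart:
  assumes "c \<in> A" "p \<in> chart_dom c"
  shows "Q p = Qc c (snd c p)"
  unfolding Q_def Let_def by (rule Qc_chart_indep[OF chart_at[OF assms] assms])

lemma Q_param: "c \<in> A \<Longrightarrow> x \<in> chart_img c \<Longrightarrow> Q (param c x) = Qc c x"
  by (simp add: Q_chart param_in_dom chart_param)

lemma continuous_Q: "continuous_map M euclideanreal Q"
proof (rule continuous_map_charts)
  fix c assume c: "c \<in> A"
  have "continuous_on (chart_img c) (Qc c)"
    by (rule yamabe_coords.continuous_Q[OF yamabe_coords_chart[OF c]])
  then show "continuous_on (chart_img c) (Q \<circ> param c)"
    by (rule continuous_on_eq) (simp add: Q_param c)
qed

lemma continuous_f: "continuous_map M euclideanreal f"
  using smooth_f unfolding smooth_fun_def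
  by (intro continuous_map_charts smooth_on_continuous_on) blast

text \<open>A global extremum is one within a chart, so the point is critical, and there Q is zero
  by its factor.\<close>

lemma Q_eq_0_at_extremum:
  assumes "\<epsilon> > 0" "p \<in> topspace M"
    and ext: "(\<forall>r\<in>topspace M. Q r - \<epsilon> * f r \<le> Q p - \<epsilon> * f p) \<or>
      (\<forall>r\<in>topspace M. Q p - \<epsilon> * f p \<le> Q r - \<epsilon> * f r)"
  shows "Q p = 0"
proof -
  obtain c where c: "c \<in> A" "p \<in> chart_dom c" using assms(2) by (auto simp: topspace_charts)
  interpret C: yamabe_coords "chart_img c" "gc c" "f \<circ> param c" "\<phi> c" \<rho>
    by (rule yamabe_coords_chart[OF c(1)])
  let ?x = "snd c p"
  have x: "?x \<in> chart_img c" using c by simp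
  have F: "Q (param c y) - \<epsilon> * f (param c y) = Qc c y - \<epsilon> * (f \<circ> param c) y" "param c y \<in> topspace M"
    if "y \<in> chart_img c" for y
    using Q_param[OF c(1) that] param_in_dom[OF c(1) that] chart_dom_subset[OF c(1)] by auto
  have "Q p - \<epsilon> * f p = Qc c ?x - \<epsilon> * (f \<circ> param c) ?x"
    using F(1)[OF x] by (simp add: param_chart c)
  then have "(\<forall>y\<in>chart_img c. Qc c y - \<epsilon> * (f \<circ> param c) y \<le> Qc c ?x - \<epsilon> * (f \<circ> param c) ?x) \<or>
      (\<forall>y\<in>chart_img c. Qc c ?x - \<epsilon> * (f \<circ> param c) ?x \<le> Qc c y - \<epsilon> * (f \<circ> param c) y)"
    using ext F by metis
  then have "C.h2 ?x = 0"
    using C.no_perturbed_extremum[OF x _ assms(1)] by blast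
  then show ?thesis by (simp add: Q_chart[OF c] C.Q_def)
qed

text \<open>The maximum of Q - \<epsilon>f bounds Q from above. Its minimum, as the maximum of -Q +
  \<epsilon>f, bounds Q from below.\<close>

lemma Q_eq_0:
  assumes M: "compact_space M" and p: "p \<in> topspace M"
  shows "Q p = 0"
proof -
  have "Q p \<le> 0"
  proof (rule compact_nonpos_by_perturbation[OF M continuous_Q _ _ p])
    show "continuous_map M euclideanreal (\<lambda>p. - f p)"
      by (intro continuous_intros continuous_f)
  qed (use Q_eq_0_at_extremum in auto)
  moreover have "- Q p \<le> 0"
  proof (rule compact_nonpos_by_perturbation[OF M _ continuous_f _ p])
    show "continuous_map M euclideanreal (\<lambda>p. - Q p)"
      by (intro continuous_intros continuous_Q)
    fix \<epsilon> :: real and p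
    assume "\<epsilon> > 0" "p \<in> topspace M"
      and max: "\<And>r. r \<in> topspace M \<Longrightarrow> - Q r + \<epsilon> * f r \<le> - Q p + \<epsilon> * f p"
    have "Q p - \<epsilon> * f p \<le> Q r - \<epsilon> * f r" if "r \<in> topspace M" for r
      using max[OF that] by linarith
    then show "- Q p = 0"
      using Q_eq_0_at_extremum[OF \<open>\<epsilon> > 0\<close> \<open>p \<in> topspace M\<close>] by simp
  qed
  ultimately show ?thesis by simp
qed

text \<open>The same value \<rho> results in every chart, so chart independence of the scalar
  curvature comes out as a by-product.\<close>

lemma scalar_curvature_eq_const:
  assumes M: "compact_space M" and c: "c \<in> A" "p \<in> chart_dom c"
  shows "scalar_curvature A g c p = \<rho>"
proof -
  interpret C: yamabe_coords "chart_img c" "gc c" "f \<circ> param c" "\<phi> c" \<rho>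
    by (rule yamabe_coords_chart[OF c(1)])
  have "C.Q y = 0" if "y \<in> chart_img c" for y
    using Q_eq_0[OF M, of "param c y"] Q_param[OF c(1) that] param_in_dom[OF c(1) that]
      chart_dom_subset[OF c(1)] by auto
  then have "\<phi> c (snd c p) = 0"
    by (rule C.\<phi>_eq_0) (use c in auto)
  then show ?thesis by (simp add: \<phi>_def scalar_curvature_def)
qed

end

theorem mainTheorem1:
  fixes M :: "'a topology"
    and A :: "('a, 'n::finite) chart set"
    and g :: "'a \<Rightarrow> (('a \<Rightarrow> real) \<Rightarrow> real) \<Rightarrow> (('a \<Rightarrow> real) \<Rightarrow> real) \<Rightarrow> real"
  assumes "CARD('n) \<ge> 3"
    and "smooth_manifold M A"
    and "compact_space M"
    and "riemannian_metric A g"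
    and "yamabe_gradient_soliton A g"
  shows "constant_scalar_curvature A g"
proof -
  obtain f \<rho> where f: "smooth_fun A f" "\<forall>c\<in>A. \<forall>p\<in>chart_dom c. \<forall>i j.
      (scalar_curvature A g c p - \<rho>) * metric_comp A g c (snd c p) $ i $ j = hessian A g c f i j p"
    using assms(5) unfolding yamabe_gradient_soliton_def by blast
  interpret yamabe_soliton M A g f \<rho>
  proof
    show "smooth_manifold M A" "riemannian_metric A g" "CARD('n) \<ge> 3" "smooth_fun A f"
      by (fact assms f)+
  qed (rule f(2)[rule_format])
  show ?thesis
    unfolding constant_scalar_curvature_def
    by (intro exI[of _ \<rho>] ballI scalar_curvature_eq_const[OF assms(3)])
qed

end
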